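(* Let $\mathcal{X}\subseteq\mathbb{R}^n$ be a polytope, let $f$ be an $(M,\nu)$ generalized self-concordant function with $\nu\ge2$ whose domain $\mathrm{dom}(f)$ does not contain any straight line, and let $\mathbf{x}_0\in\mathrm{dom}(f)$ be a vertex of $\mathcal{X}$. Then the Away-step Frank-Wolfe algorithm with backtracking (B-AFW) and the Blended Pairwise Conditional Gradients algorithm with backtracking (B-BPCG), started at $\mathbf{x}_0$, both contract the Frank-Wolfe gap linearly, i.e., $\min_{1\le t\le T}g(\mathbf{x}_t)\le\varepsilon$ after $T=\mathcal{O}(\log 1/\varepsilon)$ iterations. Precisely: for each of the two algorithms there are constants $C>0$ and $\varepsilon_0\in(0,1)$, depending only on the problem data and algorithm parameters ($f$, $\mathcal{X}$, $\mathbf{x}_0$, $L_{-1}$, $\tau$, $\eta$) and not on $\varepsilon$, such that for every $\varepsilon\in(0,\varepsilon_0]$ and every sequence of iterates $(\mathbf{x}_t)$ generated by the algorithm, there is an integer $1\le T\le C\log(1/\varepsilon)$ with $\min_{1\le t\le T}g(\mathbf{x}_t)\le\varepsilon$.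
   Context: Generalized self-concordance: let $f:\mathbb{R}^n\to\mathbb{R}\cup\{+\infty\}$ be a closed convex function whose domain $\mathrm{dom}(f)=\{\mathbf{x}: f(\mathbf{x})<+\infty\}$ is open, with $f\in C^3(\mathrm{dom}(f))$. For $M\ge 0$, $f$ is $(M,\nu)$ generalized self-concordant if for all $\mathbf{x}\in\mathrm{dom}(f)$ and $\mathbf{u},\mathbf{w}\in\mathbb{R}^n$ (with $\mathbf{w}\ne 0$ if $\nu>3$) $$|\langle D^3f(\mathbf{x})[\mathbf{w}]\mathbf{u},\mathbf{u}\rangle|\le M\,\|\mathbf{u}\|_{\nabla^2f(\mathbf{x})}^2\,\|\mathbf{w}\|_{\nabla^2f(\mathbf{x})}^{\nu-2}\,\|\mathbf{w}\|_2^{3-\nu},$$ where $D^3f(\mathbf{x})[\mathbf{w}]=\lim_{\alpha\to0}\alpha^{-1}(\nabla^2f(\mathbf{x}+\alpha\mathbf{w})-\nabla^2f(\mathbf{x}))$, $\|\mathbf{u}\|_H^2=\langle H\mathbf{u},\mathbf{u}\rangle$, and $0^0=1$. Notation: $\|\cdot\|$ is the Euclidean norm; for $\mathbf{x}\in\mathcal{X}\cap\mathrm{dom}(f)$ the Frank-Wolfe gap is $g(\mathbf{x})=\max_{\mathbf{v}\in\mathcal{X}}\langle\nabla f(\mathbf{x}),\mathbf{x}-\mathbf{v}\rangle$. Procedure Backtrack$(f,\mathbf{x},\mathbf{d},L,\gamma_{\max})$ with fixed parameters $\tau>1$ and $0<\eta\le1$: choose a starting value $K\in[\eta L,L]$ and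 set $\gamma=\min\{-\langle\nabla f(\mathbf{x}),\mathbf{d}\rangle/(K\|\mathbf{d}\|^2),\gamma_{\max}\}$ (with $\gamma=0$ if $\mathbf{d}=0$). While $\mathbf{x}+\gamma\mathbf{d}\notin\mathrm{dom}(f)$ or $f(\mathbf{x}+\gamma\mathbf{d})-f(\mathbf{x})>\frac{K\gamma^2}{2}\|\mathbf{d}\|^2+\gamma\langle\nabla f(\mathbf{x}),\mathbf{d}\rangle$, replace $K$ by $\tau K$ and recompute $\gamma$ by the same formula. Return the final pair $(\gamma,K)$. Both algorithms take a vertex $\mathbf{x}_0\in\mathrm{dom}(f)$ of $\mathcal{X}$ and an initial smoothness estimate $L_{-1}>0$, and maintain an active set $\mathcal{S}_t$ of vertices and strictly positive weights $\boldsymbol\lambda_t$ summing to one with $\mathbf{x}_t=\sum_{\mathbf{u}\in\mathcal{S}_t}\boldsymbol\lambda_t(\mathbf{u})\mathbf{u}$; initially $\mathcal{S}_0=\{\mathbf{x}_0\}$, $\boldsymbol\lambda_0(\mathbf{x}_0)=1$. At iteration $t=0,1,\dots$, choose a vertex $\mathbf{v}_t\in\arg\min_{\mathbf{v}\in\mathcal{X}}\langle\nabla f(\mathbf{x}_t),\mathbf{v}\rangle$, $\mathbf{a}_t\in\arg\max_{\mathbf{v}\in\mathcal{S}_t}\langle\nabla f(\mathbf{x}_t),\mathbf{v}\rangle$ and (for B-BPCG) $\mathbf{s}_t\in\arg\min_{\mathbf{v}\in\mathcal{S}_t}\langle\nabla f(\mathbf{x}_t),\mathbf{v}\rangle$.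 - B-AFW: if $\langle\nabla f(\mathbf{x}_t),\mathbf{x}_t-\mathbf{v}_t\rangle\ge\langle\nabla f(\mathbf{x}_t),\mathbf{a}_t-\mathbf{x}_t\rangle$ (Frank-Wolfe step), $\mathbf{d}_t=\mathbf{v}_t-\mathbf{x}_t$ and $\gamma_{\max}=1$; otherwise (away step) $\mathbf{d}_t=\mathbf{x}_t-\mathbf{a}_t$ and $\gamma_{\max}=\boldsymbol\lambda_t(\mathbf{a}_t)/(1-\boldsymbol\lambda_t(\mathbf{a}_t))$. - B-BPCG: if $\langle\nabla f(\mathbf{x}_t),\mathbf{x}_t-\mathbf{v}_t\rangle\ge\langle\nabla f(\mathbf{x}_t),\mathbf{a}_t-\mathbf{s}_t\rangle$ (Frank-Wolfe step), $\mathbf{d}_t=\mathbf{v}_t-\mathbf{x}_t$ and $\gamma_{\max}=1$; otherwise (pairwise step) $\mathbf{d}_t=\mathbf{s}_t-\mathbf{a}_t$ and $\gamma_{\max}=\boldsymbol\lambda_t(\mathbf{a}_t)$. In both, $(\gamma_t,L_t)$ is the output of Backtrack$(f,\mathbf{x}_t,\mathbf{d}_t,L_{t-1},\gamma_{\max})$ and $\mathbf{x}_{t+1}=\mathbf{x}_t+\gamma_t\mathbf{d}_t$. Weights are updated accordingly: in a Frank-Wolfe step all weights are multiplied by $1-\gamma_t$ and $\gamma_t$ is added to the weight of $\mathbf{v}_t$; in an away step all weights are multiplied by $1+\gamma_t$ and $\gamma_t$ is subtracted from the weight of $\mathbf{a}_t$; in a pairwise step $\gamma_t$ is moved from the weight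 of $\mathbf{a}_t$ to that of $\mathbf{s}_t$. $\mathcal{S}_{t+1}$ is the set of vertices with positive weight. *)

theory Defs
  imports "HOL-Analysis.Analysis" "HOL-Library.While_Combinator"
begin

section \<open>Extended-valued convex functions and their derivatives\<close>

definition effdom :: "('a \<Rightarrow> ereal) \<Rightarrow> 'a set" where
  "effdom f = {x. f x < \<infinity>}"

definition ext_epigraph :: "('a \<Rightarrow> ereal) \<Rightarrow> ('a \<times> real) set" where
  "ext_epigraph f = {(x, r). f x \<le> ereal r}"

definition closed_convex_fun :: "('a::euclidean_space \<Rightarrow> ereal) \<Rightarrow> bool" where
  "closed_convex_fun f \<longleftrightarrow>
     (\<forall>x. f x \<noteq> -\<infinity>) \<and> closed (ext_epigraph f) \<and> convex (ext_epigraph f)"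

text \<open>The value of \<open>f\<close> as a real number; only meaningful on \<open>effdom f\<close>.\<close>

definition rval :: "('a \<Rightarrow> ereal) \<Rightarrow> 'a \<Rightarrow> real" where
  "rval f x = real_of_ereal (f x)"

fun Ck_on :: "nat \<Rightarrow> ('a::euclidean_space \<Rightarrow> real) \<Rightarrow> 'a set \<Rightarrow> bool" where
  "Ck_on 0 F U \<longleftrightarrow> continuous_on U F"
| "Ck_on (Suc k) F U \<longleftrightarrow>
     (\<forall>x\<in>U. F differentiable (at x)) \<and>
     (\<forall>h. Ck_on k (\<lambda>x. frechet_derivative F (at x) h) U)"

definition grad :: "(real ^ 'n \<Rightarrow> ereal) \<Rightarrow> real ^ 'n \<Rightarrow> real ^ 'n" where
  "grad f x = (THE D. GDERIV (rval f) x :> D)"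

definition hess :: "(real ^ 'n \<Rightarrow> ereal) \<Rightarrow> real ^ 'n \<Rightarrow> real ^ 'n ^ 'n" where
  "hess f x = matrix (frechet_derivative (grad f) (at x))"

definition D3 :: "(real ^ 'n \<Rightarrow> ereal) \<Rightarrow> real ^ 'n \<Rightarrow> real ^ 'n \<Rightarrow> real ^ 'n ^ 'n" where
  "D3 f x w = Lim (at 0) (\<lambda>\<alpha>. inverse \<alpha> *\<^sub>R (hess f (x + \<alpha> *\<^sub>R w) - hess f x))"

definition mnorm :: "real ^ 'n ^ 'n \<Rightarrow> real ^ 'n \<Rightarrow> real" where
  "mnorm H u = sqrt ((H *v u) \<bullet> u)"

text \<open>Real powers with the convention \<open>0\<^sup>0 = 1\<close>; note \<open>0 powr 0 = 0\<close>.\<close>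

definition rpow :: "real \<Rightarrow> real \<Rightarrow> real" where
  "rpow b a = (if a = 0 then 1 else b powr a)"

definition gen_self_concordant :: "real \<Rightarrow> real \<Rightarrow> (real ^ 'n \<Rightarrow> ereal) \<Rightarrow> bool" where
  "gen_self_concordant M \<nu> f \<longleftrightarrow>
     M \<ge> 0 \<and> closed_convex_fun f \<and> open (effdom f) \<and> Ck_on 3 (rval f) (effdom f) \<and>
     (\<forall>x\<in>effdom f. \<forall>u w. (\<nu> > 3 \<longrightarrow> w \<noteq> 0) \<longrightarrow>
        \<bar>(D3 f x w *v u) \<bullet> u\<bar>
          \<le> M * (mnorm (hess f x) u)\<^sup>2 * rpow (mnorm (hess f x) w) (\<nu> - 2)
              * rpow (norm w) (3 - \<nu>))"

definition contains_line :: "'a::real_vector set \<Rightarrow> bool" where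
  "contains_line A \<longleftrightarrow> (\<exists>p d. d \<noteq> 0 \<and> (\<forall>t. p + t *\<^sub>R d \<in> A))"

text \<open>For a nonempty compact \<open>X\<close> the supremum is attained, i.e. it is a maximum.\<close>

definition fw_gap :: "(real ^ 'n \<Rightarrow> ereal) \<Rightarrow> (real ^ 'n) set \<Rightarrow> real ^ 'n \<Rightarrow> real" where
  "fw_gap f X x = (SUP v\<in>X. grad f x \<bullet> (x - v))"


section \<open>Backtracking\<close>

definition bt_gamma ::
    "(real ^ 'n \<Rightarrow> ereal) \<Rightarrow> real ^ 'n \<Rightarrow> real ^ 'n \<Rightarrow> real \<Rightarrow> real \<Rightarrow> real" where
  "bt_gamma f x d \<gamma>max K =
     (if d = 0 then 0 else min (- (grad f x \<bullet> d) / (K * (norm d)\<^sup>2)) \<gamma>max)"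

definition bt_reject ::
    "(real ^ 'n \<Rightarrow> ereal) \<Rightarrow> real ^ 'n \<Rightarrow> real ^ 'n \<Rightarrow> real \<Rightarrow> real \<Rightarrow> bool" where
  "bt_reject f x d \<gamma> K \<longleftrightarrow>
     x + \<gamma> *\<^sub>R d \<notin> effdom f \<or>
     rval f (x + \<gamma> *\<^sub>R d) - rval f x > K * \<gamma>\<^sup>2 / 2 * (norm d)\<^sup>2 + \<gamma> * (grad f x \<bullet> d)"

text \<open>Backtracking is a relation because the starting value \<open>K0\<close> is a free choice in
  \<open>[\<eta> L, L]\<close>. A loop that does not terminate has result \<open>None\<close>, hence yields no pair.\<close>

definition backtrack ::
    "real \<Rightarrow> real \<Rightarrow> (real ^ 'n \<Rightarrow> ereal) \<Rightarrow> real ^ 'n \<Rightarrow> real ^ 'n \<Rightarrow> real \<Rightarrow> real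
      \<Rightarrow> real \<times> real \<Rightarrow> bool" where
  "backtrack \<tau> \<eta> f x d L \<gamma>max r \<longleftrightarrow>
     (\<exists>K0\<in>{\<eta> * L..L}.
        while_option (\<lambda>(\<gamma>, K). bt_reject f x d \<gamma> K)
                     (\<lambda>(\<gamma>, K). (bt_gamma f x d \<gamma>max (\<tau> * K), \<tau> * K))
                     (bt_gamma f x d \<gamma>max K0, K0) = Some r)"


section \<open>The two algorithms\<close>

definition fw_vertex :: "(real ^ 'n \<Rightarrow> ereal) \<Rightarrow> (real ^ 'n) set \<Rightarrow> real ^ 'n \<Rightarrow> real ^ 'n \<Rightarrow> bool" where
  "fw_vertex f X x v \<longleftrightarrow> v extreme_point_of X \<and> is_arg_min (\<lambda>v. grad f x \<bullet> v) (\<lambda>v. v \<in> X) v"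

text \<open>A state \<open>(x, S, \<lambda>, L)\<close> at the beginning of iteration \<open>t\<close> consists of the iterate \<open>x\<^sub>t\<close>,
  the active set \<open>S\<^sub>t\<close>, the weights \<open>\<lambda>\<^sub>t\<close> (a total function, zero outside \<open>S\<^sub>t\<close>) and the
  current smoothness estimate, which is \<open>L\<close> with index \<open>t - 1\<close>.\<close>

type_synonym 'n state = "(real ^ 'n) \<times> (real ^ 'n) set \<times> (real ^ 'n \<Rightarrow> real) \<times> real"

definition init_state :: "real ^ 'n \<Rightarrow> real \<Rightarrow> 'n state" where
  "init_state x0 L = (x0, {x0}, (\<lambda>u. if u = x0 then 1 else 0), L)"

definition active :: "(real ^ 'n) set \<Rightarrow> (real ^ 'n \<Rightarrow> real) \<Rightarrow> (real ^ 'n) set" where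
  "active X lam = {u. u extreme_point_of X \<and> lam u > 0}"

definition fw_update ::
    "real \<Rightarrow> real \<Rightarrow> (real ^ 'n \<Rightarrow> ereal) \<Rightarrow> (real ^ 'n) set \<Rightarrow> real ^ 'n
      \<Rightarrow> 'n state \<Rightarrow> 'n state \<Rightarrow> bool" where
  "fw_update \<tau> \<eta> f X v = (\<lambda>(x, S, lam, L) (x', S', lam', L').
     \<exists>\<gamma>. backtrack \<tau> \<eta> f x (v - x) L 1 (\<gamma>, L') \<and>
         x' = x + \<gamma> *\<^sub>R (v - x) \<and>
         lam' = (\<lambda>u. (1 - \<gamma>) * lam u + (if u = v then \<gamma> else 0)) \<and>
         S' = active X lam')"

definition away_update ::
    "real \<Rightarrow> real \<Rightarrow> (real ^ 'n \<Rightarrow> ereal) \<Rightarrow> (real ^ 'n) set \<Rightarrow> real ^ 'n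
      \<Rightarrow> 'n state \<Rightarrow> 'n state \<Rightarrow> bool" where
  "away_update \<tau> \<eta> f X a = (\<lambda>(x, S, lam, L) (x', S', lam', L').
     \<exists>\<gamma>. backtrack \<tau> \<eta> f x (x - a) L (lam a / (1 - lam a)) (\<gamma>, L') \<and>
         x' = x + \<gamma> *\<^sub>R (x - a) \<and>
         lam' = (\<lambda>u. (1 + \<gamma>) * lam u - (if u = a then \<gamma> else 0)) \<and>
         S' = active X lam')"

definition pairwise_update ::
    "real \<Rightarrow> real \<Rightarrow> (real ^ 'n \<Rightarrow> ereal) \<Rightarrow> (real ^ 'n) set \<Rightarrow> real ^ 'n \<Rightarrow> real ^ 'n
      \<Rightarrow> 'n state \<Rightarrow> 'n state \<Rightarrow> bool" where
  "pairwise_update \<tau> \<eta> f X a s = (\<lambda>(x, S, lam, L) (x', S', lam', L').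
     \<exists>\<gamma>. backtrack \<tau> \<eta> f x (s - a) L (lam a) (\<gamma>, L') \<and>
         x' = x + \<gamma> *\<^sub>R (s - a) \<and>
         lam' = (\<lambda>u. lam u + (if u = s then \<gamma> else 0) - (if u = a then \<gamma> else 0)) \<and>
         S' = active X lam')"

definition bafw_step ::
    "real \<Rightarrow> real \<Rightarrow> (real ^ 'n \<Rightarrow> ereal) \<Rightarrow> (real ^ 'n) set \<Rightarrow> 'n state \<Rightarrow> 'n state \<Rightarrow> bool" where
  "bafw_step \<tau> \<eta> f X = (\<lambda>(x, S, lam, L) st'.
     \<exists>v a. fw_vertex f X x v \<and> is_arg_max (\<lambda>v. grad f x \<bullet> v) (\<lambda>v. v \<in> S) a \<and>
       (if grad f x \<bullet> (x - v) \<ge> grad f x \<bullet> (a - x)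
        then fw_update \<tau> \<eta> f X v (x, S, lam, L) st'
        else away_update \<tau> \<eta> f X a (x, S, lam, L) st'))"

definition bbpcg_step ::
    "real \<Rightarrow> real \<Rightarrow> (real ^ 'n \<Rightarrow> ereal) \<Rightarrow> (real ^ 'n) set \<Rightarrow> 'n state \<Rightarrow> 'n state \<Rightarrow> bool" where
  "bbpcg_step \<tau> \<eta> f X = (\<lambda>(x, S, lam, L) st'.
     \<exists>v a s. fw_vertex f X x v \<and> is_arg_max (\<lambda>v. grad f x \<bullet> v) (\<lambda>v. v \<in> S) a \<and>
       is_arg_min (\<lambda>v. grad f x \<bullet> v) (\<lambda>v. v \<in> S) s \<and>
       (if grad f x \<bullet> (x - v) \<ge> grad f x \<bullet> (a - s)
        then fw_update \<tau> \<eta> f X v (x, S, lam, L) st'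
        else pairwise_update \<tau> \<eta> f X a s (x, S, lam, L) st'))"

definition generated ::
    "('n state \<Rightarrow> 'n state \<Rightarrow> bool) \<Rightarrow> real ^ 'n \<Rightarrow> real \<Rightarrow> (nat \<Rightarrow> real ^ 'n) \<Rightarrow> bool" where
  "generated step x0 L xs \<longleftrightarrow>
     (\<exists>st. st 0 = init_state x0 L \<and> (\<forall>t. step (st t) (st (Suc t))) \<and> (\<forall>t. xs t = fst (st t)))"

end

theory Submission
  imports Defs
begin

text \<open>Self-concordance with \<open>\<nu> \<ge> 2\<close> and a domain without lines force a positive definite Hessian,
  so on the compact set \<open>X \<inter> {f \<le> f(x\<^sub>0) + 1}\<close> the function is smooth and strongly convex;
  smoothness bounds the estimates \<open>L\<^sub>t\<close>. If \<open>D\<close> is the decrease rate of \<open>f\<close> along the chosen direction,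
  every step that does not drop a vertex decreases \<open>f\<close> by at least a multiple of \<open>D\<^sup>2\<close> or by \<open>D / 2\<close>.
  Here \<open>D\<close> dominates the Frank-Wolfe gap and half of \<open>\<langle>\<nabla>f(x), a - v\<rangle>\<close>, and the latter is bounded below
  by the square root of the primal gap, via strong convexity and the geometry of the polytope.
  Hence the primal gap contracts in such steps and also bounds the squared Frank-Wolfe gap there.
  Drop steps are at most as frequent as the other steps, because they shrink the active set.\<close>

section \<open>Closed convex functions of class \<open>C\<^sup>3\<close>\<close>

text \<open>In general \<open>f\<close> has no smoothness constant on all of \<open>X\<close>: the
  boundary of its domain may cut through \<open>X\<close>, and \<open>f\<close> may blow up there.
  All constants are therefore taken from a sublevel set of the starting point, slightly enlarged so
  that a trial step can be followed up to its end. The Frank-Wolfe gap itself need not be monotone,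
  and a drop step guarantees no more than that \<open>f\<close> does not increase; so the rate is
  run on the primal gap, and a small Frank-Wolfe gap is read off at a later good step. Ties and the
  starting value of each line search are free choices, which forces constants that are uniform over
  all runs.\<close>

lemma convex_ray_segment:
  assumes "convex A" "x \<in> A" "x + s *\<^sub>R u \<in> A" "0 \<le> t" "t \<le> s"
  shows "x + t *\<^sub>R u \<in> A"
proof (cases "s = 0")
  case False
  with assms have "(1 - t / s) *\<^sub>R x + (t / s) *\<^sub>R (x + s *\<^sub>R u) \<in> A"
    by (intro convexD[OF assms(1)]) auto
  moreover have "(1 - t / s) *\<^sub>R x + (t / s) *\<^sub>R (x + s *\<^sub>R u) = x + t *\<^sub>R u"
    using False by (simp add: algebra_simps)
  ultimately show ?thesis by simp
qed (use assms in auto)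

text \<open>Kept apart from self-concordance, which serves to make the Hessian definite: the
  analysis of the iterations sees \<open>f\<close> through this regularity and the curvature
  bounds.\<close>

locale C3_closed_convex =
  fixes f :: "real ^ 'n \<Rightarrow> ereal"
  assumes closed_convex: "closed_convex_fun f"
    and open_dom: "open (effdom f)"
    and C3: "Ck_on 3 (rval f) (effdom f)"
begin

abbreviation "F \<equiv> rval f"
abbreviation "U \<equiv> effdom f"

lemma f_eq: "x \<in> U \<Longrightarrow> f x = ereal (F x)"
  using closed_convex by (cases "f x") (auto simp: effdom_def rval_def closed_convex_fun_def)

lemma le_iff: "f x \<le> ereal c \<longleftrightarrow> x \<in> U \<and> F x \<le> c"
proof
  assume *: "f x \<le> ereal c"
  then have "x \<in> U" unfolding effdom_def using less_PInf_Ex_of_nat[of "f x"]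
    by (auto intro: order_le_less_trans)
  with * show "x \<in> U \<and> F x \<le> c" using f_eq by auto
qed (use f_eq in auto)

lemma epigraph_eq: "ext_epigraph f = {(x, r). x \<in> U \<and> F x \<le> r}"
  unfolding ext_epigraph_def using le_iff by auto

lemma convex_U: "convex U"
  and convex_on_F: "convex_on U F"
proof -
  have epi: "convex (ext_epigraph f)"
    using closed_convex by (simp add: closed_convex_fun_def)
  have *: "u *\<^sub>R x + v *\<^sub>R y \<in> U \<and> F (u *\<^sub>R x + v *\<^sub>R y) \<le> u * F x + v * F y"
    if "x \<in> U" "y \<in> U" "0 \<le> u" "0 \<le> v" "u + v = 1" for x y u v
  proof -
    have "u *\<^sub>R (x, F x) + v *\<^sub>R (y, F y) \<in> ext_epigraph f"
      by (rule convexD[OF epi]) (use that in \<open>auto simp: epigraph_eq\<close>)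
    then show ?thesis by (simp add: epigraph_eq)
  qed
  then show "convex U" by (auto simp: convex_def)
  with * show "convex_on U F" by (auto simp: convex_on_def)
qed

text \<open>A slice of the closed epigraph, hence closed in the whole space although
  \<open>U\<close> is open; cut with a polytope it becomes a compact subset of
  \<open>U\<close>.\<close>

lemma closed_sublevel: "closed {x \<in> U. F x \<le> c}"
proof -
  have "closed ((\<lambda>x. (x, c)) -` ext_epigraph f)"
    using closed_convex unfolding closed_convex_fun_def
    by (intro continuous_closed_vimage) (auto intro!: continuous_intros)
  moreover have "(\<lambda>x. (x, c)) -` ext_epigraph f = {x \<in> U. F x \<le> c}"
    by (auto simp: epigraph_eq)
  ultimately show ?thesis by simp
qed

lemma convex_sublevel: "convex {x \<in> U. F x \<le> c}"
proof (rule convexI)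
  fix x y and u v :: real
  assume "x \<in> {x \<in> U. F x \<le> c}" "y \<in> {x \<in> U. F x \<le> c}" and uv: "0 \<le> u" "0 \<le> v" "u + v = 1"
  then have xy: "x \<in> U" "F x \<le> c" "y \<in> U" "F y \<le> c" by auto
  have "F (u *\<^sub>R x + v *\<^sub>R y) \<le> u * F x + v * F y"
    using convex_on_F xy uv by (simp add: convex_on_def)
  also have "\<dots> \<le> u * c + v * c"
    using xy uv by (intro add_mono mult_left_mono) auto
  also have "\<dots> = c" using uv by (metis distrib_right mult_1)
  finally show "u *\<^sub>R x + v *\<^sub>R y \<in> {x \<in> U. F x \<le> c}"
    using convexD[OF convex_U] xy uv by auto
qed

subsection \<open>Derivatives\<close>

lemma Ck_1: "Ck_on 1 (\<lambda>x. frechet_derivative (\<lambda>x. frechet_derivative F (at x) h) (at x) k) U"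
  and differentiable_dF: "x \<in> U \<Longrightarrow> (\<lambda>x. frechet_derivative F (at x) h) differentiable (at x)"
  and differentiable_F: "x \<in> U \<Longrightarrow> F differentiable (at x)"
  using C3 by (simp_all add: numeral_3_eq_3)

lemma differentiable_ddF:
  "x \<in> U \<Longrightarrow> (\<lambda>x. frechet_derivative (\<lambda>x. frechet_derivative F (at x) h) (at x) k)
    differentiable (at x)"
  using Ck_1[of h k] by simp

text \<open>\<open>grad\<close> is a definite description, so existence and uniqueness have to be
  supplied; \<open>adjoint ?d 1\<close> is the Riesz representer of the derivative
  \<open>?d\<close>.\<close>

lemma GDERIV_grad:
  assumes "x \<in> U"
  shows "GDERIV F x :> grad f x"
proof -
  let ?d = "frechet_derivative F (at x)"
  have d: "(F has_derivative ?d) (at x)"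
    using differentiable_F[OF assms] frechet_derivative_works by blast
  then have lin: "linear ?d" using has_derivative_linear by blast
  have "?d h = h \<bullet> adjoint ?d 1" for h
    using adjoint_works[OF lin, of h 1] by (simp add: inner_commute)
  then have "?d = (\<lambda>h. h \<bullet> adjoint ?d 1)" by (rule ext)
  with d have ex: "GDERIV F x :> adjoint ?d 1" by (simp add: gderiv_def)
  have "E = adjoint ?d 1" if "GDERIV F x :> E" for E
  proof -
    have "(\<lambda>h. h \<bullet> E) = (\<lambda>h. h \<bullet> adjoint ?d 1)"
      using that ex has_derivative_unique unfolding gderiv_def by blast
    then have "\<forall>h. h \<bullet> E = h \<bullet> adjoint ?d 1" by (intro allI) (rule fun_cong)
    then show ?thesis by (simp only: vector_eq_ldot)
  qed
  with ex show ?thesis unfolding grad_def by (rule theI)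
qed

lemma has_derivative_F: "x \<in> U \<Longrightarrow> (F has_derivative (\<lambda>h. grad f x \<bullet> h)) (at x)"
  using GDERIV_grad by (simp add: gderiv_def inner_commute)

lemma frechet_derivative_F: "x \<in> U \<Longrightarrow> frechet_derivative F (at x) h = grad f x \<bullet> h"
  using frechet_derivative_at[OF has_derivative_F] by metis

lemma grad_comp_derivative:
  assumes "x \<in> U"
  shows "((\<lambda>x. grad f x \<bullet> h) has_derivative
    frechet_derivative (\<lambda>x. frechet_derivative F (at x) h) (at x)) (at x)"
proof (rule has_derivative_transform_within_open[OF _ open_dom assms])
  show "((\<lambda>x. frechet_derivative F (at x) h) has_derivative
    frechet_derivative (\<lambda>x. frechet_derivative F (at x) h) (at x)) (at x)"
    using differentiable_dF[OF assms] frechet_derivative_works by blast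
qed (rule frechet_derivative_F)

lemma has_derivative_grad:
  assumes "x \<in> U"
  shows "(grad f has_derivative (\<lambda>h. hess f x *v h)) (at x)"
proof -
  have "grad f differentiable (at x)"
    using differentiableI[OF grad_comp_derivative[OF assms]]
    by (subst differentiable_componentwise_within) blast
  then show ?thesis by (simp only: jacobian_works hess_def jacobian_def)
qed

text \<open>Links the Jacobian of \<open>grad\<close> to the iterated directional derivatives that
  \<open>Ck_on\<close> controls; this is how the third order of smoothness reaches
  \<open>hess\<close>.\<close>

lemma hess_component:
  assumes "x \<in> U"
  shows "hess f x $ i $ j =
    frechet_derivative (\<lambda>x. frechet_derivative F (at x) (axis i 1)) (at x) (axis j 1)"
proof -
  have "((\<lambda>x. grad f x \<bullet> axis i 1) has_derivative (\<lambda>h. (hess f x *v h) \<bullet> axis i 1)) (at x)"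
    by (intro has_derivative_inner_left has_derivative_grad assms)
  then have "(\<lambda>h. (hess f x *v h) \<bullet> axis i 1) =
    frechet_derivative (\<lambda>x. frechet_derivative F (at x) (axis i 1)) (at x)"
    using grad_comp_derivative[OF assms] has_derivative_unique by blast
  then have "(hess f x *v axis j 1) \<bullet> axis i 1 =
    frechet_derivative (\<lambda>x. frechet_derivative F (at x) (axis i 1)) (at x) (axis j 1)"
    by metis
  then show ?thesis
    by (simp add: inner_axis matrix_vector_mult_basis column_def)
qed

lemma differentiable_hess:
  assumes "x \<in> U"
  shows "(\<lambda>x. hess f x $ i $ j) differentiable (at x)"
proof -
  let ?D = "\<lambda>x. frechet_derivative (\<lambda>x. frechet_derivative F (at x) (axis i 1)) (at x) (axis j 1)"
  have "(?D has_derivative frechet_derivative ?D (at x)) (at x)"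
    using differentiable_ddF[OF assms] frechet_derivative_works by blast
  then have "((\<lambda>x. hess f x $ i $ j) has_derivative frechet_derivative ?D (at x)) (at x)"
    by (rule has_derivative_transform_within_open[OF _ open_dom assms]) (simp add: hess_component)
  then show ?thesis by (auto simp: differentiable_def)
qed

lemma continuous_on_hess: "continuous_on U (hess f)"
proof -
  have "continuous_on U (\<lambda>x. \<chi> i j. hess f x $ i $ j)"
    by (intro continuous_on_vec_lambda continuous_at_imp_continuous_on ballI
        differentiable_imp_continuous_within differentiable_hess)
  then show ?thesis by simp
qed

lemma continuous_on_F: "continuous_on U F"
  by (intro continuous_at_imp_continuous_on ballI differentiable_imp_continuous_within
      differentiable_F)

text \<open>On the domain this is the square of \<open>mnorm (hess f x) u\<close>. Without the root
  it is differentiable along lines even where it vanishes.\<close>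

definition quad :: "real ^ 'n \<Rightarrow> real ^ 'n \<Rightarrow> real" where
  "quad x u = (hess f x *v u) \<bullet> u"

lemma quad_alt: "quad x u = (\<Sum>i\<in>UNIV. \<Sum>j\<in>UNIV. hess f x $ i $ j * u $ j * u $ i)"
  by (simp add: quad_def inner_vec_def matrix_vector_mult_def sum_distrib_right)

lemma quad_scale: "quad x (c *\<^sub>R u) = c\<^sup>2 * quad x u"
  by (simp add: quad_def matrix_vector_mult_scaleR power2_eq_square)

section \<open>Derivatives along lines\<close>

lemma has_derivative_line: "((\<lambda>t. x + t *\<^sub>R u) has_derivative (\<lambda>t. t *\<^sub>R u)) (at (t::real))"
  by (auto intro!: derivative_eq_intros)

lemma DERIV_F_line:
  assumes "x + t *\<^sub>R u \<in> U"
  shows "DERIV (\<lambda>t. F (x + t *\<^sub>R u)) t :> grad f (x + t *\<^sub>R u) \<bullet> u"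
  using has_derivative_compose[OF has_derivative_line has_derivative_F[OF assms]]
  by (simp add: has_field_derivative_def mult_commute_abs)

lemma DERIV_grad_line:
  assumes "x + t *\<^sub>R u \<in> U"
  shows "DERIV (\<lambda>t. grad f (x + t *\<^sub>R u) \<bullet> u) t :> quad (x + t *\<^sub>R u) u"
  using has_derivative_inner_left[OF has_derivative_compose[OF has_derivative_line has_derivative_grad[OF assms]]]
  by (simp add: has_field_derivative_def mult_commute_abs quad_def matrix_vector_mult_scaleR)

text \<open>\<open>Lim\<close> is a definite description as well, so convergence has to be proved;
  it holds entrywise because the entries of \<open>hess\<close> are differentiable.\<close>

lemma D3_tendsto:
  assumes "x \<in> U"
  shows "((\<lambda>\<alpha>. inverse \<alpha> *\<^sub>R (hess f (x + \<alpha> *\<^sub>R w) - hess f x)) \<longlongrightarrow> D3 f x w) (at 0)"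
proof -
  define d where "d i j = (SOME d. ((\<lambda>\<alpha>. inverse \<alpha> * (hess f (x + \<alpha> *\<^sub>R w) $ i $ j - hess f x $ i $ j)) \<longlongrightarrow> d) (at 0))"
    for i j
  have "\<exists>d. ((\<lambda>\<alpha>. inverse \<alpha> * (hess f (x + \<alpha> *\<^sub>R w) $ i $ j - hess f x $ i $ j)) \<longlongrightarrow> d) (at 0)"
    for i j
  proof -
    obtain D where D: "((\<lambda>x. hess f x $ i $ j) has_derivative D) (at (x + 0 *\<^sub>R w))"
      using differentiable_hess[OF assms] by (auto simp: differentiable_def)
    have "((\<lambda>t. hess f (x + t *\<^sub>R w) $ i $ j) has_derivative (\<lambda>t. t * D w)) (at 0)"
      using has_derivative_compose[OF has_derivative_line D] linear_scale[OF has_derivative_linear[OF D]]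
      by simp
    then have "DERIV (\<lambda>t. hess f (x + t *\<^sub>R w) $ i $ j) 0 :> D w"
      by (simp add: has_field_derivative_def mult_commute_abs)
    then show ?thesis by (auto simp: DERIV_def field_simps)
  qed
  then have d: "((\<lambda>\<alpha>. inverse \<alpha> * (hess f (x + \<alpha> *\<^sub>R w) $ i $ j - hess f x $ i $ j)) \<longlongrightarrow> d i j) (at 0)" for i j
    unfolding d_def by (rule someI_ex)
  have "((\<lambda>\<alpha>. inverse \<alpha> *\<^sub>R (hess f (x + \<alpha> *\<^sub>R w) - hess f x)) \<longlongrightarrow> (\<chi> i j. d i j)) (at 0)"
    using d by (intro vec_tendstoI) simp
  moreover from this have "D3 f x w = (\<chi> i j. d i j)"
    unfolding D3_def by (intro tendsto_Lim) simp_all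
  ultimately show ?thesis by simp
qed

text \<open>With \<open>w = u\<close>, the third-order term of self-concordance becomes the
  derivative of the curvature along the line.\<close>

lemma DERIV_quad_line:
  assumes "x + t *\<^sub>R u \<in> U"
  shows "DERIV (\<lambda>t. quad (x + t *\<^sub>R u) u) t :> (D3 f (x + t *\<^sub>R u) u *v u) \<bullet> u"
proof -
  have *: "((\<lambda>\<alpha>. ((inverse \<alpha> *\<^sub>R (hess f ((x + t *\<^sub>R u) + \<alpha> *\<^sub>R u) - hess f (x + t *\<^sub>R u))) *v u) \<bullet> u)
    \<longlongrightarrow> (D3 f (x + t *\<^sub>R u) u *v u) \<bullet> u) (at 0)"
    unfolding inner_vec_def matrix_vector_mult_def vec_lambda_beta
    by (intro tendsto_intros D3_tendsto assms)
  show ?thesis unfolding DERIV_def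
    by (rule Lim_transform_eventually[OF *])
      (simp add: quad_def matrix_vector_mult_diff_rdistrib scaleR_matrix_vector_assoc[symmetric]
        inner_diff_left scaleR_add_left add.assoc divide_inverse mult.commute)
qed

section \<open>Taylor expansion and convexity along segments\<close>

lemma open_line: "open {t. x + t *\<^sub>R u \<in> U}"
  using open_vimage[OF open_dom, of "\<lambda>t. x + t *\<^sub>R u"]
  by (simp add: vimage_def continuous_intros)

lemmas segment_dom = convex_ray_segment[OF convex_U]

text \<open>Maclaurin expansion of \<open>F\<close> along the segment. The location of
  \<open>z\<close> matters: it stays in every convex set that contains \<open>x\<close> and
  \<open>y\<close>.\<close>

lemma taylor2:
  assumes "x \<in> U" "y \<in> U"
  obtains z where "z \<in> closed_segment x y"
    "F y = F x + grad f x \<bullet> (y - x) + quad z (y - x) / 2"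
proof -
  let ?u = "y - x"
  have dom: "x + t *\<^sub>R ?u \<in> U" if "0 \<le> t" "t \<le> 1" for t
    using segment_dom[of x 1 ?u t] assms that by simp
  define D where "D = (\<lambda>(m::nat) t. if m = 0 then F (x + t *\<^sub>R ?u) else
    if m = 1 then grad f (x + t *\<^sub>R ?u) \<bullet> ?u else quad (x + t *\<^sub>R ?u) ?u)"
  have D': "D 0 = (\<lambda>t. F (x + t *\<^sub>R ?u))" "D (Suc 0) = (\<lambda>t. grad f (x + t *\<^sub>R ?u) \<bullet> ?u)"
    "D 2 = (\<lambda>t. quad (x + t *\<^sub>R ?u) ?u)" by (auto simp: D_def)
  have "\<forall>m t. m < 2 \<and> 0 \<le> t \<and> t \<le> 1 \<longrightarrow> DERIV (D m) t :> D (Suc m) t"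
    using DERIV_F_line[OF dom] DERIV_grad_line[OF dom] D'
    by (auto simp: less_2_cases_iff numeral_2_eq_2[symmetric])
  from Maclaurin[OF zero_less_one pos2 refl this]
  obtain t where t: "0 < t" "t < 1" "D 0 1 = (\<Sum>m<2. D m 0 / fact m * 1 ^ m) + D 2 t / fact 2 * 1\<^sup>2"
    by blast
  show ?thesis
  proof
    show "x + t *\<^sub>R ?u \<in> closed_segment x y"
      using t by (auto simp: closed_segment_def algebra_simps intro!: exI[of _ t])
    show "F y = F x + grad f x \<bullet> (y - x) + quad (x + t *\<^sub>R ?u) (y - x) / 2"
      using t(3) by (simp add: D_def numeral_2_eq_2)
  qed
qed

text \<open>Reduced to a convex real function on a line. It rests on convexity rather than on
  \<open>taylor2\<close>, because the sign of \<open>quad\<close> is derived from it.\<close>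

lemma above_tangent:
  assumes "x \<in> U" "y \<in> U"
  shows "F y \<ge> F x + grad f x \<bullet> (y - x)"
proof -
  let ?g = "\<lambda>t. F (x + t *\<^sub>R (y - x))"
  let ?A = "{t. x + t *\<^sub>R (y - x) \<in> U}"
  have conv: "convex_on ?A ?g"
  proof (rule convex_onI)
    show cA: "convex ?A"
    proof (rule convexI)
      fix s t u v :: real assume *: "s \<in> ?A" "t \<in> ?A" "0 \<le> u" "0 \<le> v" "u + v = 1"
      then have "u *\<^sub>R (x + s *\<^sub>R (y - x)) + v *\<^sub>R (x + t *\<^sub>R (y - x)) \<in> U"
        by (intro convexD[OF convex_U]) auto
      moreover have "u *\<^sub>R (x + s *\<^sub>R (y - x)) + v *\<^sub>R (x + t *\<^sub>R (y - x))
        = (u + v) *\<^sub>R x + (u * s + v * t) *\<^sub>R (y - x)"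
        by (simp add: algebra_simps)
      ultimately show "u *\<^sub>R s + v *\<^sub>R t \<in> ?A" using * by simp
    qed
    fix t a b :: real assume *: "0 < t" "t < 1" "a \<in> ?A" "b \<in> ?A"
    have "x + ((1 - t) *\<^sub>R a + t *\<^sub>R b) *\<^sub>R (y - x)
      = (1 - t) *\<^sub>R (x + a *\<^sub>R (y - x)) + t *\<^sub>R (x + b *\<^sub>R (y - x))"
      by (simp add: algebra_simps)
    then show "?g ((1 - t) *\<^sub>R a + t *\<^sub>R b) \<le> (1 - t) * ?g a + t * ?g b"
      using convex_onD[OF convex_on_F, of t "x + a *\<^sub>R (y - x)" "x + b *\<^sub>R (y - x)"] * by simp
  qed
  have "?g 1 - ?g 0 \<ge> (grad f x \<bullet> (y - x)) * (1 - 0)"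
  proof (rule convex_on_imp_above_tangent[OF conv])
    show "connected ?A" using conv convex_on_imp_convex convex_connected by blast
    show "(?g has_real_derivative grad f x \<bullet> (y - x)) (at 0 within ?A)"
      using DERIV_F_line[of x 0 "y - x"] assms by (auto intro: has_field_derivative_at_within)
  qed (use open_line[of x "y - x"] assms in \<open>auto simp: interior_open\<close>)
  then show ?thesis by simp
qed

text \<open>The tangent inequalities at both ends add up to monotonicity of the gradient along the
  line, so the difference quotients converging to \<open>quad\<close> are nonnegative.\<close>

lemma quad_nonneg:
  assumes "x \<in> U"
  shows "quad x u \<ge> 0"
proof -
  have ev: "\<forall>\<^sub>F t in at 0. x + t *\<^sub>R u \<in> U"
    using open_line[of x u] assms by (auto simp: eventually_at_topological)
  have lim: "((\<lambda>t. (grad f (x + (0 + t) *\<^sub>R u) \<bullet> u - grad f (x + 0 *\<^sub>R u) \<bullet> u) / t) \<longlongrightarrow> quad (x + 0 *\<^sub>R u) u) (at 0)"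
    using DERIV_grad_line[of x 0 u] assms by (simp add: DERIV_def)
  have "0 \<le> quad (x + 0 *\<^sub>R u) u"
  proof (rule tendsto_lowerbound[OF lim])
    show "\<forall>\<^sub>F t in at 0. 0 \<le> (grad f (x + (0 + t) *\<^sub>R u) \<bullet> u - grad f (x + 0 *\<^sub>R u) \<bullet> u) / t"
      using ev
    proof eventually_elim
      case (elim t)
      have "F (x + t *\<^sub>R u) \<ge> F x + t * (grad f x \<bullet> u)"
        using above_tangent[OF assms elim] by simp
      moreover have "F x \<ge> F (x + t *\<^sub>R u) - t * (grad f (x + t *\<^sub>R u) \<bullet> u)"
        using above_tangent[OF elim assms] by simp
      ultimately have "t * (grad f (x + t *\<^sub>R u) \<bullet> u - grad f x \<bullet> u) \<ge> 0"
        by (simp add: algebra_simps)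
      then show ?case by (auto simp: zero_le_mult_iff zero_le_divide_iff)
    qed
  qed simp
  then show ?thesis by simp
qed

end

section \<open>Positive definiteness of the Hessian\<close>

context C3_closed_convex
begin

lemma continuous_on_quad: "continuous_on (U \<times> UNIV) (\<lambda>p. quad (fst p) (snd p))"
proof -
  have "continuous_on (U \<times> UNIV) (\<lambda>p::(real ^ 'n) \<times> (real ^ 'n). hess f (fst p))"
    by (rule continuous_on_compose2[OF continuous_on_hess]) (auto intro!: continuous_intros)
  then show ?thesis unfolding quad_alt by (intro continuous_intros)
qed

lemma taylor_bounds:
  assumes "convex K" "K \<subseteq> U" "x \<in> K" "y \<in> K"
    and "\<And>z u. z \<in> K \<Longrightarrow> \<mu> * (norm u)\<^sup>2 \<le> quad z u \<and> quad z u \<le> L * (norm u)\<^sup>2"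
  shows "F x + grad f x \<bullet> (y - x) + \<mu> / 2 * (norm (y - x))\<^sup>2 \<le> F y"
    and "F y \<le> F x + grad f x \<bullet> (y - x) + L / 2 * (norm (y - x))\<^sup>2"
proof -
  obtain z where z: "z \<in> closed_segment x y"
    "F y = F x + grad f x \<bullet> (y - x) + quad z (y - x) / 2"
    using taylor2 assms by blast
  then have "z \<in> K" using assms closed_segment_subset by blast
  from assms(5)[OF this, of "y - x"] z(2)
  show "F x + grad f x \<bullet> (y - x) + \<mu> / 2 * (norm (y - x))\<^sup>2 \<le> F y"
    and "F y \<le> F x + grad f x \<bullet> (y - x) + L / 2 * (norm (y - x))\<^sup>2" by simp_all
qed

end

locale gsc_no_line =
  fixes f :: "real ^ 'n \<Rightarrow> ereal" and M \<nu> :: real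
  assumes gsc: "gen_self_concordant M \<nu> f"
    and nu: "2 \<le> \<nu>"
    and no_line: "\<not> contains_line (effdom f)"
begin

sublocale C3_closed_convex f
  using gsc by unfold_locales (simp_all add: gen_self_concordant_def)

lemma rpow_mono: "0 \<le> a \<Longrightarrow> 0 \<le> x \<Longrightarrow> x \<le> y \<Longrightarrow> rpow x a \<le> rpow y a"
  by (simp add: rpow_def powr_mono2)

lemma rpow_nonneg: "0 \<le> rpow x a"
  by (simp add: rpow_def)

text \<open>Since \<open>\<nu> \<ge> 2\<close>, along a line self-concordance is a differential inequality
  \<open>\<bar>\<psi>'\<bar> \<le> C \<psi>\<close> for \<open>\<psi> t = \<nabla>\<^sup>2f(x + t u)[u, u]\<close>, so Gronwall propagates zeros of \<open>\<psi>\<close>.\<close>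

lemma quad_zero_forward:
  assumes "x \<in> U" "x + s *\<^sub>R u \<in> U" "0 \<le> s" "quad x u = 0" "u \<noteq> 0"
  shows "quad (x + s *\<^sub>R u) u = 0"
proof -
  let ?\<psi> = "\<lambda>t. quad (x + t *\<^sub>R u) u"
  let ?\<psi>' = "\<lambda>t. (D3 f (x + t *\<^sub>R u) u *v u) \<bullet> u"
  have dom: "x + t *\<^sub>R u \<in> U" if "0 \<le> t" "t \<le> s" for t
    using segment_dom that assms by blast
  have "continuous_on {0..s} ?\<psi>"
    using DERIV_quad_line[OF dom]
    by (intro continuous_at_imp_continuous_on ballI DERIV_isCont) auto
  then have "bdd_above (?\<psi> ` {0..s})"
    by (intro bounded_imp_bdd_above compact_imp_bounded compact_continuous_image) auto
  then obtain B where B: "\<forall>t\<in>{0..s}. ?\<psi> t \<le> B"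
    unfolding bdd_above_def by auto
  \<comment> \<open>As \<open>\<nu> - 2 \<ge> 0\<close>, this power of the local norm is at most its
    value at the bound \<open>B\<close>; only the factor \<open>?\<psi> t\<close> stays variable, so
    the inequality becomes linear.\<close>
  define C where "C = M * rpow (sqrt B) (\<nu> - 2) * rpow (norm u) (3 - \<nu>)"
  have ineq: "\<bar>?\<psi>' t\<bar> \<le> C * ?\<psi> t" if "t \<in> {0..s}" for t
  proof -
    have t: "x + t *\<^sub>R u \<in> U" using dom that by auto
    have q: "0 \<le> ?\<psi> t" using quad_nonneg t by blast
    have m: "mnorm (hess f (x + t *\<^sub>R u)) u = sqrt (?\<psi> t)" by (simp add: mnorm_def quad_def)
    have "\<bar>?\<psi>' t\<bar> \<le> M * ?\<psi> t * rpow (sqrt (?\<psi> t)) (\<nu> - 2) * rpow (norm u) (3 - \<nu>)"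
      using gsc t \<open>u \<noteq> 0\<close> q unfolding gen_self_concordant_def
      by (metis m real_sqrt_pow2)
    also have "\<dots> \<le> M * ?\<psi> t * rpow (sqrt B) (\<nu> - 2) * rpow (norm u) (3 - \<nu>)"
      using gsc nu q B that unfolding gen_self_concordant_def
      by (intro mult_right_mono mult_left_mono rpow_mono rpow_nonneg) auto
    finally show ?thesis by (simp add: C_def mult_ac)
  qed
  let ?E = "\<lambda>t. ?\<psi> t * exp (- C * t)"
  have "?E s \<le> ?E 0"
  proof (rule DERIV_nonpos_imp_nonincreasing[OF \<open>0 \<le> s\<close>])
    fix t assume t: "0 \<le> t" "t \<le> s"
    have "DERIV ?E t :> (?\<psi>' t - C * ?\<psi> t) * exp (- C * t)"
      using DERIV_quad_line[OF dom[OF t]]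
      by (auto intro!: derivative_eq_intros simp: algebra_simps)
    moreover have "(?\<psi>' t - C * ?\<psi> t) * exp (- C * t) \<le> 0"
      using ineq[of t] t by (intro mult_nonpos_nonneg) auto
    ultimately show "\<exists>y. DERIV ?E t :> y \<and> y \<le> 0" by blast
  qed
  then have "?\<psi> s \<le> 0" using assms by (simp add: mult_le_0_iff)
  then show ?thesis using quad_nonneg assms by (meson order_antisym)
qed

text \<open>\<open>quad\<close> is even in the direction, so going backwards along \<open>u\<close>
  is going forwards along \<open>- u\<close>.\<close>

lemma quad_zero_line:
  assumes "x \<in> U" "x + s *\<^sub>R u \<in> U" "quad x u = 0" "u \<noteq> 0"
  shows "quad (x + s *\<^sub>R u) u = 0"
proof (cases "0 \<le> s")
  case False
  have neg: "quad y (- u) = quad y u" for y using quad_scale[of y "-1" u] by simp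
  have "quad (x + (- s) *\<^sub>R (- u)) (- u) = 0"
    by (rule quad_zero_forward) (use False assms neg in auto)
  then show ?thesis using neg by simp
qed (use quad_zero_forward assms in blast)

text \<open>If \<open>\<nabla>\<^sup>2f(x)[u, u] = 0\<close>, then \<open>f\<close> is affine on the part of the line \<open>x + \<real> u\<close> in its open
  domain; as the epigraph is closed, that part is also closed, hence it is the whole line.\<close>

lemma quad_pos:
  assumes x: "x \<in> U" and u: "u \<noteq> 0"
  shows "0 < quad x u"
proof (rule ccontr)
  assume "\<not> 0 < quad x u"
  then have q0: "quad x u = 0" using quad_nonneg[OF x, of u] by simp
  let ?I = "{t. x + t *\<^sub>R u \<in> U}"
  have affine: "F (x + t *\<^sub>R u) = F x + t * (grad f x \<bullet> u)" if t: "x + t *\<^sub>R u \<in> U" for t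
  proof -
    obtain z where z: "z \<in> closed_segment x (x + t *\<^sub>R u)"
      "F (x + t *\<^sub>R u) = F x + grad f x \<bullet> (t *\<^sub>R u) + quad z (t *\<^sub>R u) / 2"
      using taylor2[OF x t] by auto
    have "z \<in> U" using z(1) closed_segment_subset[OF x t convex_U] by blast
    moreover obtain c where "z = (1 - c) *\<^sub>R x + c *\<^sub>R (x + t *\<^sub>R u)"
      using z(1) by (auto simp: closed_segment_def)
    then have "z = x + (c * t) *\<^sub>R u" by (simp add: algebra_simps)
    ultimately have "quad z u = 0" using quad_zero_line x q0 u by blast
    then show ?thesis using z(2) by (simp add: quad_scale)
  qed
  \<comment> \<open>This graph of an affine function is continuous on the whole line, also where
    \<open>F\<close> carries no information; membership in the epigraph then detects the
    domain.\<close>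
  have "?I = (\<lambda>t. (x + t *\<^sub>R u, F x + t * (grad f x \<bullet> u))) -` ext_epigraph f"
    using affine by (auto simp: epigraph_eq)
  moreover have "closed ((\<lambda>t. (x + t *\<^sub>R u, F x + t * (grad f x \<bullet> u))) -` ext_epigraph f)"
    using closed_convex unfolding closed_convex_fun_def
    by (intro continuous_closed_vimage) (auto intro!: continuous_intros)
  ultimately have "closed ?I" by simp
  moreover have "0 \<in> ?I" using x by simp
  ultimately have "?I = UNIV" using clopen[of ?I] open_line[of x u] by blast
  then have "contains_line U" unfolding contains_line_def using u by blast
  then show False using no_line by blast
qed

text \<open>\<open>quad\<close> is positive and jointly continuous on \<open>K\<close> times the
  unit sphere, so its extrema there are attained; quadratic scaling extends them to all
  \<open>u\<close>.\<close>

lemma quad_bounds: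
  assumes "compact K" "K \<subseteq> U" "K \<noteq> {}"
  obtains \<mu> L where "0 < \<mu>" "0 < L"
    "\<And>x u. x \<in> K \<Longrightarrow> \<mu> * (norm u)\<^sup>2 \<le> quad x u \<and> quad x u \<le> L * (norm u)\<^sup>2"
proof -
  let ?S = "K \<times> sphere (0 :: real ^ 'n) 1"
  let ?q = "\<lambda>p. quad (fst p) (snd p)"
  have comp: "compact ?S" using assms by (intro compact_Times) auto
  have ne: "?S \<noteq> {}"
  proof -
    have "axis undefined 1 \<in> sphere (0 :: real ^ 'n) 1" by simp
    then show ?thesis using assms by blast
  qed
  have cont: "continuous_on ?S ?q"
    by (rule continuous_on_subset[OF continuous_on_quad]) (use assms in auto)
  obtain p where p: "p \<in> ?S" "\<And>r. r \<in> ?S \<Longrightarrow> ?q p \<le> ?q r"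
    using continuous_attains_inf[OF comp ne cont] by blast
  obtain p' where p': "p' \<in> ?S" "\<And>r. r \<in> ?S \<Longrightarrow> ?q r \<le> ?q p'"
    using continuous_attains_sup[OF comp ne cont] by blast
  have pos: "0 < ?q p" using p(1) assms by (intro quad_pos) auto
  show thesis
  proof
    show "0 < ?q p" by (rule pos)
    show "0 < ?q p'" using pos p(2)[OF p'(1)] by linarith
    fix x u assume x: "x \<in> K"
    show "?q p * (norm u)\<^sup>2 \<le> quad x u \<and> quad x u \<le> ?q p' * (norm u)\<^sup>2"
    proof (cases "u = 0")
      case True
      then show ?thesis by (simp add: quad_def)
    next
      case False
      have "(x, sgn u) \<in> ?S" using x False by (simp add: norm_sgn)
      then have "?q p \<le> quad x (sgn u)" "quad x (sgn u) \<le> ?q p'" using p(2) p'(2) by fastforce+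
      moreover have "quad x u = quad x (sgn u) * (norm u)\<^sup>2"
        using quad_scale[of x "norm u" "sgn u"] False by (simp add: sgn_div_norm)
      ultimately show ?thesis by (simp add: mult_right_mono)
    qed
  qed
qed

end

section \<open>A linear error bound for convex combinations\<close>

text \<open>Among all weights \<open>m\<close> of \<open>y\<close> take those differing from \<open>l\<close> in the fewest places. The sets of
  vertices where \<open>l > m\<close> and where \<open>l < m\<close> then have disjoint hulls: a common point would allow
  to shift \<open>m\<close> towards \<open>l\<close> without changing \<open>y\<close> until one more place agrees.\<close>

lemma disjoint_hull_decomposition:
  fixes V :: "'a::real_vector set"
  assumes V: "finite V"
    and l: "\<And>u. u \<in> V \<Longrightarrow> 0 \<le> l u" "sum l V = 1"
    and y: "y \<in> convex hull V"
  assumes ne: "(\<Sum>u\<in>V. l u *\<^sub>R u) \<noteq> y"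
  obtains \<theta> P Q a b where "(0::real) < \<theta>" "P \<subseteq> {u \<in> V. 0 < l u}" "Q \<subseteq> V"
    "convex hull P \<inter> convex hull Q = {}" "a \<in> convex hull P" "b \<in> convex hull Q"
    "(\<Sum>u\<in>V. l u *\<^sub>R u) - y = \<theta> *\<^sub>R (a - b)"
proof -
  define W where "W m \<longleftrightarrow> (\<forall>u\<in>V. 0 \<le> m u) \<and> sum m V = 1 \<and> (\<Sum>u\<in>V. m u *\<^sub>R u) = y"
    for m :: "'a \<Rightarrow> real"
  have "\<exists>m. W m" using y by (auto simp: convex_hull_finite[OF V] W_def)
  then obtain m where m: "W m"
    and least: "\<And>m'. W m' \<Longrightarrow> card {u \<in> V. l u \<noteq> m u} \<le> card {u \<in> V. l u \<noteq> m' u}"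
    using ex_has_least_nat[of W _ "\<lambda>m. card {u \<in> V. l u \<noteq> m u}"] by blast
  define P Q where "P = {u \<in> V. m u < l u}" and "Q = {u \<in> V. l u < m u}"
  define \<theta> where "\<theta> = (\<Sum>u\<in>P. l u - m u)"
  have fin: "finite P" "finite Q" using V by (auto simp: P_def Q_def)
  \<comment> \<open>Polymorphic in the values of \<open>h\<close>: the constant 1 shows that equal
    masses sit on \<open>P\<close> and \<open>Q\<close>, the identity yields the
    displacement.\<close>
  have split: "(\<Sum>u\<in>V. (l u - m u) *\<^sub>R h u) = (\<Sum>u\<in>P. (l u - m u) *\<^sub>R h u) - (\<Sum>u\<in>Q. (m u - l u) *\<^sub>R h u)"
    for h :: "'a \<Rightarrow> 'b::real_vector"
  proof -
    have "(\<Sum>u\<in>V. (l u - m u) *\<^sub>R h u) = (\<Sum>u\<in>P \<union> Q. (l u - m u) *\<^sub>R h u)"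
      using V by (intro sum.mono_neutral_right) (auto simp: P_def Q_def)
    also have "\<dots> = (\<Sum>u\<in>P. (l u - m u) *\<^sub>R h u) + (\<Sum>u\<in>Q. (l u - m u) *\<^sub>R h u)"
      using fin by (intro sum.union_disjoint) (auto simp: P_def Q_def)
    also have "(\<Sum>u\<in>Q. (l u - m u) *\<^sub>R h u) = - (\<Sum>u\<in>Q. (m u - l u) *\<^sub>R h u)"
      unfolding sum_negf[symmetric] by (intro sum.cong refl) (simp add: algebra_simps)
    finally show ?thesis by simp
  qed
  have "(\<Sum>u\<in>V. l u - m u) = 0" using l m by (simp add: W_def sum_subtractf)
  then have \<theta>': "\<theta> = (\<Sum>u\<in>Q. m u - l u)" using split[of "\<lambda>_. 1::real"] by (simp add: \<theta>_def)
  have "\<theta> \<noteq> 0"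
  proof
    assume "\<theta> = 0"
    then have "P = {}" "Q = {}"
      using fin \<theta>' sum_pos[of P "\<lambda>u. l u - m u"] sum_pos[of Q "\<lambda>u. m u - l u"]
      by (force simp: \<theta>_def P_def Q_def)+
    then have "\<And>u. u \<in> V \<Longrightarrow> l u = m u" by (force simp: P_def Q_def)
    then show False using ne m by (simp add: W_def)
  qed
  moreover have "0 \<le> \<theta>" unfolding \<theta>_def by (intro sum_nonneg) (auto simp: P_def)
  ultimately have \<theta>: "0 < \<theta>" by simp
  define a where "a = (\<Sum>u\<in>P. ((l u - m u) / \<theta>) *\<^sub>R u)"
  define b where "b = (\<Sum>u\<in>Q. ((m u - l u) / \<theta>) *\<^sub>R u)"
  show thesis
  proof
    show "0 < \<theta>" by (rule \<theta>)
    show "P \<subseteq> {u \<in> V. 0 < l u}" using m by (force simp: P_def W_def)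
    show "Q \<subseteq> V" by (auto simp: Q_def)
    show "a \<in> convex hull P"
      unfolding convex_hull_finite[OF fin(1)] a_def using \<theta>
      by (auto intro!: exI[of _ "\<lambda>u. (l u - m u) / \<theta>"] simp: P_def sum_divide_distrib[symmetric])
        (simp add: \<theta>_def P_def)
    show "b \<in> convex hull Q"
      unfolding convex_hull_finite[OF fin(2)] b_def using \<theta>
      by (auto intro!: exI[of _ "\<lambda>u. (m u - l u) / \<theta>"] simp: Q_def sum_divide_distrib[symmetric])
        (simp add: \<theta>' Q_def)
    have "(\<Sum>u\<in>V. l u *\<^sub>R u) - y = (\<Sum>u\<in>V. (l u - m u) *\<^sub>R u)"
      using m by (simp add: W_def algebra_simps sum_subtractf)
    also have "\<dots> = \<theta> *\<^sub>R (a - b)"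
      using \<theta> by (simp add: split a_def b_def scaleR_diff_right scaleR_sum_right)
    finally show "(\<Sum>u\<in>V. l u *\<^sub>R u) - y = \<theta> *\<^sub>R (a - b)" .
    show "convex hull P \<inter> convex hull Q = {}"
    proof (rule ccontr)
      assume "convex hull P \<inter> convex hull Q \<noteq> {}"
      then obtain w where w: "w \<in> convex hull P" "w \<in> convex hull Q" by blast
      obtain p where p: "\<forall>u\<in>P. 0 \<le> p u" "sum p P = (1::real)" "(\<Sum>u\<in>P. p u *\<^sub>R u) = w"
        using w(1) by (auto simp: convex_hull_finite[OF fin(1)])
      obtain q where q: "\<forall>u\<in>Q. 0 \<le> q u" "sum q Q = (1::real)" "(\<Sum>u\<in>Q. q u *\<^sub>R u) = w"
        using w(2) by (auto simp: convex_hull_finite[OF fin(2)])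
      have pq: "(\<Sum>u\<in>P. p u *\<^sub>R u) = (\<Sum>u\<in>Q. q u *\<^sub>R u)" using p q by simp
      define z where "z u = (if u \<in> P then p u else 0) - (if u \<in> Q then q u else 0)" for u
      have PV: "V \<inter> P = P" "V \<inter> Q = Q" by (auto simp: P_def Q_def)
      have sumz: "sum z V = 0"
        using V PV p q unfolding z_def by (simp add: sum_subtractf sum.If_cases)
      have sumzu: "(\<Sum>u\<in>V. z u *\<^sub>R u) = 0"
        using V PV pq unfolding z_def
        by (simp add: scaleR_diff_left sum_subtractf if_distrib[of "\<lambda>c. c *\<^sub>R _"] sum.If_cases
            cong: if_cong)
      define T where "T = {u \<in> V. z u \<noteq> 0}"
      \<comment> \<open>\<open>r u\<close> is the step at which the weight of \<open>u\<close>
        reaches \<open>l u\<close>, and \<open>\<epsilon>\<close> is the first such step. No weight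
        overshoots \<open>l\<close>, so none becomes negative.\<close>
      define r where "r u = (l u - m u) / z u" for u
      define \<epsilon> where "\<epsilon> = Min (r ` T)"
      have "T \<noteq> {}"
      proof -
        obtain u where "u \<in> P" "p u \<noteq> 0" using p(2) by (metis sum.neutral zero_neq_one)
        then have "u \<in> T" by (auto simp: T_def z_def P_def Q_def)
        then show ?thesis by blast
      qed
      then have "\<epsilon> \<in> r ` T" and \<epsilon>le: "\<And>u. u \<in> T \<Longrightarrow> \<epsilon> \<le> r u"
        using V by (auto simp: \<epsilon>_def T_def)
      then obtain w where w: "w \<in> T" "\<epsilon> = r w" by blast
      have zP: "0 < z u" if "u \<in> T" "u \<in> P" for u
        using that p(1) by (auto simp: T_def z_def P_def Q_def)
      have zQ: "z u < 0" if "u \<in> T" "u \<in> Q" for u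
        using that q(1) by (auto simp: T_def z_def P_def Q_def)
      have TPQ: "u \<in> P \<or> u \<in> Q" if "u \<in> T" for u using that by (auto simp: T_def z_def split: if_splits)
      have "0 < \<epsilon>"
        using TPQ[OF w(1)] zP[OF w(1)] zQ[OF w(1)] w(2)
        by (auto simp: r_def P_def Q_def zero_less_divide_iff)
      let ?m = "\<lambda>u. m u + \<epsilon> * z u"
      have "W ?m"
        unfolding W_def
      proof (intro conjI ballI)
        fix u assume u: "u \<in> V"
        show "0 \<le> ?m u"
        proof (cases "u \<in> T")
          case False
          then show ?thesis using u m by (auto simp: T_def W_def)
        next
          case True
          from TPQ[OF True] show ?thesis
          proof
            assume "u \<in> P"
            then show ?thesis using u m zP[OF True] \<open>0 < \<epsilon>\<close> by (simp add: W_def)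
          next
            assume "u \<in> Q"
            then have "l u - m u \<le> \<epsilon> * z u"
              using zQ[OF True] \<epsilon>le[OF True] by (simp add: r_def neg_le_divide_eq)
            then show ?thesis using l(1)[OF u] by linarith
          qed
        qed
      next
        show "sum ?m V = 1"
          using m sumz by (simp add: W_def sum.distrib sum_distrib_left[symmetric])
        show "(\<Sum>u\<in>V. ?m u *\<^sub>R u) = y"
          using m sumzu
          by (simp add: W_def scaleR_add_left sum.distrib scaleR_sum_right[symmetric]
              scaleR_scaleR[symmetric] del: scaleR_scaleR)
      qed
      from least[OF this]
      have "card {u \<in> V. l u \<noteq> m u} \<le> card {u \<in> V. l u \<noteq> ?m u}" .
      moreover have "{u \<in> V. l u \<noteq> ?m u} \<subset> {u \<in> V. l u \<noteq> m u}"
      proof -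
        have "z u = 0" if "l u = m u" for u using that by (simp add: z_def P_def Q_def)
        moreover have "w \<in> V" "l w \<noteq> m w" "l w = ?m w"
          using w TPQ[OF w(1)] by (auto simp: T_def P_def Q_def r_def)
        ultimately show ?thesis by force
      qed
      then have "card {u \<in> V. l u \<noteq> ?m u} < card {u \<in> V. l u \<noteq> m u}"
        using V by (intro psubset_card_mono) auto
      ultimately show False by simp
    qed
  qed
qed

text \<open>Only finitely many pairs of subsets occur, and disjoint compact hulls have positive
  distance.\<close>

lemma disjoint_hulls_separated:
  fixes V :: "'a::euclidean_space set"
  assumes "finite V"
  shows "\<exists>c>0. \<forall>P Q a b. P \<subseteq> V \<and> Q \<subseteq> V \<and> convex hull P \<inter> convex hull Q = {} \<and>
    a \<in> convex hull P \<and> b \<in> convex hull Q \<longrightarrow> c \<le> norm (a - b)"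
proof -
  define D where "D = {(P, Q). P \<subseteq> V \<and> Q \<subseteq> V \<and> P \<noteq> {} \<and> Q \<noteq> {} \<and> convex hull P \<inter> convex hull Q = {}}"
  let ?d = "\<lambda>(P, Q). setdist (convex hull P) (convex hull Q)"
  have "finite D"
    by (rule finite_subset[of _ "Pow V \<times> Pow V"]) (use assms in \<open>auto simp: D_def\<close>)
  then have fin: "finite (insert 1 (?d ` D))" by simp
  have pos: "0 < ?d p" if "p \<in> D" for p
  proof -
    obtain P Q where "p = (P, Q)" by (cases p)
    with that have p: "p = (P, Q)" "P \<subseteq> V" "Q \<subseteq> V" "P \<noteq> {}" "Q \<noteq> {}"
      "convex hull P \<inter> convex hull Q = {}"
      by (auto simp: D_def)
    then have "compact (convex hull P)" "compact (convex hull Q)"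
      using assms finite_subset by (blast intro: finite_imp_compact_convex_hull)+
    then show ?thesis
      using p by (simp add: setdist_gt_0_compact_closed compact_imp_closed)
  qed
  show ?thesis
  \<comment> \<open>The inserted 1 keeps the minimum defined when there is no such pair.\<close>
  proof (intro exI[of _ "Min (insert 1 (?d ` D))"] conjI allI impI; (elim conjE)?)
    show "0 < Min (insert 1 (?d ` D))" using fin pos by (subst Min_gr_iff) auto
    fix P Q a b
    assume *: "P \<subseteq> V" "Q \<subseteq> V" "convex hull P \<inter> convex hull Q = {}" "a \<in> convex hull P" "b \<in> convex hull Q"
    then have "(P, Q) \<in> D" by (auto simp: D_def)
    then have "?d (P, Q) \<in> insert 1 (?d ` D)" by (intro insertI2 imageI)
    then have "Min (insert 1 (?d ` D)) \<le> ?d (P, Q)" using fin by (intro Min_le)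
    also have "\<dots> \<le> norm (a - b)" using setdist_le_dist[OF *(4,5)] by (simp add: dist_norm)
    finally show "Min (insert 1 (?d ` D)) \<le> norm (a - b)" .
  qed
qed

text \<open>The constant plays the role of the pyramidal width of the polytope and is uniform in the
  gradient \<open>g\<close>. In \<open>x - y = \<theta> (a' - b')\<close> the scale
  \<open>\<theta>\<close> cancels; \<open>a'\<close> averages active vertices and \<open>b'\<close>
  averages vertices, so \<open>g \<bullet> (a' - b') \<le> g \<bullet> (a - v)\<close>, while
  \<open>c \<le> norm (a' - b')\<close>.\<close>

lemma pyramidal_width:
  fixes V :: "'a::euclidean_space set"
  assumes V: "finite V"
  shows "\<exists>c>0. \<forall>l y g a v.
    (\<forall>u\<in>V. 0 \<le> l u) \<and> sum l V = 1 \<and> y \<in> convex hull V \<and>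
    (\<forall>u\<in>V. 0 < l u \<longrightarrow> g \<bullet> u \<le> g \<bullet> a) \<and> (\<forall>u\<in>V. g \<bullet> v \<le> g \<bullet> u) \<longrightarrow>
    c * (g \<bullet> ((\<Sum>u\<in>V. l u *\<^sub>R u) - y)) \<le> (g \<bullet> (a - v)) * norm ((\<Sum>u\<in>V. l u *\<^sub>R u) - y)"
proof -
  obtain c where c: "0 < c" "\<forall>P Q a b. P \<subseteq> V \<and> Q \<subseteq> V \<and> convex hull P \<inter> convex hull Q = {} \<and>
    a \<in> convex hull P \<and> b \<in> convex hull Q \<longrightarrow> c \<le> norm (a - b)"
    using disjoint_hulls_separated[OF V] by blast
  show ?thesis
  proof (intro exI[of _ c] conjI allI impI; (elim conjE)?)
    show "0 < c" by fact
    fix l :: "'a \<Rightarrow> real" and y g a v :: 'a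
    assume l: "\<forall>u\<in>V. 0 \<le> l u" "sum l V = 1" and y: "y \<in> convex hull V"
      and a: "\<forall>u\<in>V. 0 < l u \<longrightarrow> g \<bullet> u \<le> g \<bullet> a"
      and v: "\<forall>u\<in>V. g \<bullet> v \<le> g \<bullet> u"
    let ?x = "\<Sum>u\<in>V. l u *\<^sub>R u"
    show "c * (g \<bullet> (?x - y)) \<le> (g \<bullet> (a - v)) * norm (?x - y)"
    proof (cases "?x = y")
      case False
      from disjoint_hull_decomposition[OF V bspec[OF l(1)] l(2) y this]
      obtain \<theta> P Q a' b' where *: "0 < \<theta>" "P \<subseteq> {u \<in> V. 0 < l u}" "Q \<subseteq> V"
        "convex hull P \<inter> convex hull Q = {}" "a' \<in> convex hull P" "b' \<in> convex hull Q"
        "?x - y = \<theta> *\<^sub>R (a' - b')" by blast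
      have "convex hull P \<subseteq> {u. g \<bullet> u \<le> g \<bullet> a}"
        using *(2) a by (intro hull_minimal convex_halfspace_le) auto
      moreover have "convex hull Q \<subseteq> {u. g \<bullet> u \<ge> g \<bullet> v}"
        using *(3) v by (intro hull_minimal convex_halfspace_ge) auto
      ultimately have "g \<bullet> a' \<le> g \<bullet> a" "g \<bullet> v \<le> g \<bullet> b'" using *(5,6) by auto
      then have 1: "g \<bullet> (a' - b') \<le> g \<bullet> (a - v)" by (simp add: inner_diff_right)
      have "P \<noteq> {}" using *(5) by auto
      then have 2: "0 \<le> g \<bullet> (a - v)"
        using *(2) a v by (force simp: inner_diff_right)
      have "c \<le> norm (a' - b')" using c(2) * by blast
      then have "c * (g \<bullet> (a - v)) \<le> (g \<bullet> (a - v)) * norm (a' - b')"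
        using mult_right_mono[OF _ 2] by (simp add: mult.commute)
      moreover have "c * (g \<bullet> (a' - b')) \<le> c * (g \<bullet> (a - v))" using 1 c(1) by simp
      ultimately have "c * (g \<bullet> (a' - b')) \<le> (g \<bullet> (a - v)) * norm (a' - b')" by linarith
      then show ?thesis using *(1) by (simp add: *(7) mult_left_mono mult.left_commute)
    qed simp
  qed
qed

section \<open>Linear rates with drop steps\<close>

text \<open>Think of \<open>n t\<close> as the size of the active set: it grows by at most one in a good step and
  shrinks in a drop step, so at most half of the steps are drop steps.\<close>

lemma linear_rate_with_drops:
  fixes \<kappa> \<rho> H :: real and N :: nat
  assumes "0 < \<kappa>" "0 < \<rho>" "\<rho> < 1" "0 < H"
  shows "\<exists>C \<epsilon>0 :: real. 0 < C \<and> 0 < \<epsilon>0 \<and> \<epsilon>0 < 1 \<and>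
    (\<forall>\<epsilon> h g n. 0 < \<epsilon> \<and> \<epsilon> \<le> \<epsilon>0 \<and> h 0 \<le> H \<and> (\<forall>t. 1 \<le> n t) \<and> (\<forall>t. n t \<le> N) \<and>
      (\<forall>t. h (Suc t) \<le> \<rho> * h t \<and> n (Suc t) \<le> Suc (n t) \<and>
             (0 < g t \<longrightarrow> \<kappa> * (min 1 (g t))\<^sup>2 \<le> h t) \<or>
           h (Suc t) \<le> h t \<and> n (Suc t) < n t) \<longrightarrow>
      (\<exists>T. 1 \<le> T \<and> real T \<le> C * ln (1 / \<epsilon>) \<and> (\<exists>t\<in>{1..T}. g t \<le> \<epsilon>)))"
proof -
  \<comment> \<open>The potential \<open>t + n t\<close> grows by at most 2 in a good step and not
    at all in a drop step, so each unit of it can be charged a factor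
    \<open>sqrt \<rho>\<close>.\<close>
  define \<sigma> where "\<sigma> = sqrt \<rho>"
  have \<sigma>: "0 < \<sigma>" "\<sigma> < 1" "\<rho> = \<sigma>\<^sup>2" using assms by (auto simp: \<sigma>_def)
  \<comment> \<open>The bound \<open>n 0 \<le> N\<close> limits the head start of the potential;
    \<open>H'\<close> absorbs it.\<close>
  define H' where "H' = H / \<sigma> ^ N"
  have H': "0 < H'" using assms \<sigma> by (simp add: H'_def)
  define l where "l = - ln \<sigma>"
  have l: "0 < l" using \<sigma> by (simp add: l_def)
  \<comment> \<open>\<open>2 + N\<close> pays for rounding up to \<open>m\<close> and for the
    \<open>N\<close> further indices among which a good step is sought; \<open>B\<close> comes from
    the square in \<open>\<epsilon>\<^sup>2\<close>.\<close>
  define A where "A = \<bar>ln H' - ln \<kappa>\<bar> / l + 2 + N"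
  define B where "B = 2 / l"
  have "0 \<le> \<bar>ln H' - ln \<kappa>\<bar> / l" using l by simp
  then have AB: "0 < A" "0 < B" using l unfolding A_def B_def by (linarith, simp)
  show ?thesis
  \<comment> \<open>\<open>\<epsilon> \<le> exp (-1)\<close> gives
    \<open>ln (1 / \<epsilon>) \<ge> 1\<close>, so the additive constant \<open>A\<close> can be
    turned into a factor.\<close>
  proof (rule exI[of _ "A + B"], rule exI[of _ "exp (-1)"], intro conjI allI impI; (elim conjE)?)
    show "0 < A + B" using AB by simp
    show "0 < exp (-1 :: real)" "exp (-1 :: real) < 1" by simp_all
    fix \<epsilon> :: real and h g :: "nat \<Rightarrow> real" and n :: "nat \<Rightarrow> nat"
    assume \<epsilon>: "0 < \<epsilon>" "\<epsilon> \<le> exp (-1)" and h0: "h 0 \<le> H"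
      and n1: "\<forall>t. 1 \<le> n t" and nN: "\<forall>t. n t \<le> N"
      and step: "\<forall>t. h (Suc t) \<le> \<rho> * h t \<and> n (Suc t) \<le> Suc (n t) \<and> (0 < g t \<longrightarrow> \<kappa> * (min 1 (g t))\<^sup>2 \<le> h t) \<or>
           h (Suc t) \<le> h t \<and> n (Suc t) < n t"
    define e where "e = - ln \<epsilon>"
    have "ln \<epsilon> \<le> ln (exp (-1))" using \<epsilon> by (intro ln_mono) auto
    then have e: "1 \<le> e" by (simp add: e_def)
    have lne: "ln (1 / \<epsilon>) = e" using \<epsilon> by (simp add: e_def ln_div)
    \<comment> \<open>\<open>b\<close> is the real exponent at which
      \<open>H' * \<sigma> ^ b\<close> equals \<open>\<kappa> * \<epsilon>\<^sup>2\<close>. The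
      extra 1 in \<open>m\<close> also ensures \<open>1 \<le> m\<close>, as index 0 does not
      count.\<close>
    define b where "b = (ln H' - ln \<kappa> + 2 * e) / l"
    define m where "m = nat \<lceil>b\<rceil> + 1"
    have m: "b < m" unfolding m_def by linarith
    have "real m \<le> \<bar>b\<bar> + 2" unfolding m_def by linarith
    also have "\<bar>b\<bar> \<le> \<bar>ln H' - ln \<kappa>\<bar> / l + B * e"
    proof -
      have "\<bar>b\<bar> = \<bar>ln H' - ln \<kappa> + 2 * e\<bar> / l" using l by (simp add: b_def abs_divide)
      also have "\<dots> \<le> (\<bar>ln H' - ln \<kappa>\<bar> + 2 * e) / l"
        using l e by (intro divide_right_mono) auto
      finally show ?thesis by (simp add: B_def add_divide_distrib)
    qed
    finally have "real (m + N) \<le> A + B * e" by (simp add: A_def)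
    also have "\<dots> \<le> A * e + B * e" using AB e by simp
    finally have T: "real (m + N) \<le> (A + B) * ln (1 / \<epsilon>)" by (simp add: lne distrib_right)
    have inv: "h t * \<sigma> ^ N \<le> H * \<sigma> ^ (t + n t)" for t
    proof (induction t)
      case 0
      have "\<sigma> ^ N \<le> \<sigma> ^ n 0" using \<sigma> nN by (intro power_decreasing) auto
      then have "H * \<sigma> ^ N \<le> H * \<sigma> ^ n 0" using assms by simp
      moreover have "h 0 * \<sigma> ^ N \<le> H * \<sigma> ^ N" using h0 \<sigma> by simp
      ultimately show ?case by simp
    next
      case (Suc t)
      from step[rule_format, of t] show ?case
      proof (elim disjE conjE)
        assume *: "h (Suc t) \<le> \<rho> * h t" "n (Suc t) \<le> Suc (n t)"
        have "h (Suc t) * \<sigma> ^ N \<le> \<sigma>\<^sup>2 * (h t * \<sigma> ^ N)"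
          using * \<sigma> by (simp add: mult.assoc[symmetric])
        also have "\<dots> \<le> \<sigma>\<^sup>2 * (H * \<sigma> ^ (t + n t))"
          using Suc \<sigma> by (intro mult_left_mono) auto
        also have "\<dots> = H * \<sigma> ^ (t + n t + 2)"
          by (simp add: power_add power2_eq_square mult_ac)
        also have "\<dots> \<le> H * \<sigma> ^ (Suc t + n (Suc t))"
          using * \<sigma> assms by (intro mult_left_mono power_decreasing) auto
        finally show ?thesis .
      next
        assume *: "h (Suc t) \<le> h t" "n (Suc t) < n t"
        have "h (Suc t) * \<sigma> ^ N \<le> h t * \<sigma> ^ N" using * \<sigma> by simp
        also have "\<dots> \<le> H * \<sigma> ^ (t + n t)" by (rule Suc)
        also have "\<dots> \<le> H * \<sigma> ^ (Suc t + n (Suc t))"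
          using * \<sigma> assms by (intro mult_left_mono power_decreasing) auto
        finally show ?thesis .
      qed
    qed
    have decay: "h t \<le> H' * \<sigma> ^ m" if "m \<le> t" for t
    proof -
      have "H * \<sigma> ^ (t + n t) \<le> H * \<sigma> ^ m"
        using \<sigma> assms that by (intro mult_left_mono power_decreasing) auto
      with inv[of t] have "h t * \<sigma> ^ N \<le> H * \<sigma> ^ m" by linarith
      then show ?thesis using \<sigma> by (simp add: H'_def field_simps)
    qed
    have small: "H' * \<sigma> ^ m < \<kappa> * \<epsilon>\<^sup>2"
    proof -
      have "ln H' - ln \<kappa> + 2 * e < real m * l" using m l by (simp add: b_def field_simps)
      then have "ln (H' * \<sigma> ^ m) < ln (\<kappa> * \<epsilon>\<^sup>2)"
        using H' \<sigma> assms \<epsilon> by (simp add: ln_mult ln_realpow l_def e_def)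
      then show ?thesis using H' \<sigma> assms \<epsilon> by (simp add: ln_less_cancel_iff)
    qed
    \<comment> \<open>The gap is controlled in good steps only, but \<open>N + 1\<close> consecutive
      drops would push \<open>n\<close> from at most \<open>N\<close> below zero.\<close>
    have "\<exists>t\<in>{m..m + N}. h (Suc t) \<le> \<rho> * h t \<and> (0 < g t \<longrightarrow> \<kappa> * (min 1 (g t))\<^sup>2 \<le> h t)"
    proof (rule ccontr)
      assume no: "\<not> ?thesis"
      have "k \<le> Suc N \<Longrightarrow> n (m + k) + k \<le> n m" for k
      proof (induction k)
        case (Suc k)
        then have "m + k \<in> {m..m + N}" by simp
        then have "n (Suc (m + k)) < n (m + k)" using step[rule_format, of "m + k"] no by blast
        then show ?case using Suc by simp
      qed simp
      from this[of "Suc N"] nN[rule_format, of m] show False by simp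
    qed
    then obtain t where t: "t \<in> {m..m + N}" "0 < g t \<longrightarrow> \<kappa> * (min 1 (g t))\<^sup>2 \<le> h t" by blast
    have "g t \<le> \<epsilon>"
    proof (rule ccontr)
      assume "\<not> g t \<le> \<epsilon>"
      moreover have "\<epsilon> < 1" using \<epsilon>(2) by (rule order_le_less_trans) simp
      ultimately have "\<epsilon>\<^sup>2 \<le> (min 1 (g t))\<^sup>2" "0 < g t" using \<epsilon> by (auto intro!: power_mono)
      then have "\<kappa> * \<epsilon>\<^sup>2 \<le> h t" using t(2) assms by (meson mult_left_mono order_less_imp_le order_trans)
      then show False using small decay[of t] t(1) by simp
    qed
    moreover have "1 \<le> m" by (simp add: m_def)
    ultimately show "\<exists>T. 1 \<le> T \<and> real T \<le> (A + B) * ln (1 / \<epsilon>) \<and> (\<exists>t\<in>{1..T}. g t \<le> \<epsilon>)"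
      using t(1) T by (intro exI[of _ "m + N"]) auto
  qed
qed

section \<open>One iteration of the algorithms\<close>

text \<open>The curvature bounds hold up to level \<open>c0 + 1\<close>, so that they cover a neighbourhood in \<open>X\<close> of the
  sublevel set of level \<open>c0\<close> which contains the iterates.\<close>

locale fw_constants = C3_closed_convex f for f :: "real ^ 'n \<Rightarrow> ereal" +
  fixes X :: "(real ^ 'n) set" and xm :: "real ^ 'n"
    and c0 \<mu> L \<Delta> \<tau> \<eta> Linit pw :: real
  assumes polytope: "polytope X"
    and tau: "1 < \<tau>" and eta: "0 < \<eta>" and Linit: "0 < Linit"
    and L: "0 < L" and mu: "0 < \<mu>" and Delta: "0 < \<Delta>" and pw: "0 < pw"
    and curvature: "\<And>z u. z \<in> X \<Longrightarrow> z \<in> U \<Longrightarrow> F z \<le> c0 + 1 \<Longrightarrow>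
      \<mu> * (norm u)\<^sup>2 \<le> quad z u \<and> quad z u \<le> L * (norm u)\<^sup>2"
    and diameter: "\<And>x y. x \<in> X \<Longrightarrow> y \<in> X \<Longrightarrow> norm (x - y) \<le> \<Delta>"
    and width: "\<forall>l y g a v.
      (\<forall>u\<in>{u. u extreme_point_of X}. 0 \<le> l u) \<and> sum l {u. u extreme_point_of X} = 1 \<and>
      y \<in> convex hull {u. u extreme_point_of X} \<and>
      (\<forall>u\<in>{u. u extreme_point_of X}. 0 < l u \<longrightarrow> g \<bullet> u \<le> g \<bullet> a) \<and>
      (\<forall>u\<in>{u. u extreme_point_of X}. g \<bullet> v \<le> g \<bullet> u) \<longrightarrow>
      pw * (g \<bullet> ((\<Sum>u\<in>{u. u extreme_point_of X}. l u *\<^sub>R u) - y))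
        \<le> (g \<bullet> (a - v)) * norm ((\<Sum>u\<in>{u. u extreme_point_of X}. l u *\<^sub>R u) - y)"
    and xm: "xm \<in> X" "xm \<in> U" "\<And>x. x \<in> X \<Longrightarrow> x \<in> U \<Longrightarrow> F xm \<le> F x"
begin

abbreviation "V \<equiv> {u. u extreme_point_of X}"

text \<open>A rejected estimate lies below \<open>L\<close>, so one more factor
  \<open>\<tau>\<close> keeps it under \<open>\<tau> * L\<close>; \<open>Linit\<close> covers a
  large starting estimate.\<close>

definition "Kmax = max Linit (\<tau> * L)"
text \<open>A step of uncapped length \<open>D / (K * (norm d)\<^sup>2)\<close> gains half of its
  linear decrease, a multiple of \<open>D\<^sup>2\<close>; this is the worst coefficient.\<close>

definition "\<kappa> = 1 / (2 * Kmax * \<Delta>\<^sup>2)"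
text \<open>One entry for each guaranteed decrease, with primal gap \<open>h\<close>:
  \<open>D / 2\<close> against \<open>h \<le> D\<close>, and \<open>\<kappa> * D\<^sup>2\<close>
  against \<open>\<mu> * pw\<^sup>2 / 2 * h \<le> D\<^sup>2\<close>.\<close>

definition "\<rho> = 1 - min (1 / 2) (\<kappa> * \<mu> * pw\<^sup>2 / 2)"

lemma Kmax: "0 < Kmax"
  using Linit by (simp add: Kmax_def)

lemma kappa: "0 < \<kappa>"
  using Kmax Delta by (simp add: \<kappa>_def)

lemma rho: "0 < \<rho>" "\<rho> < 1"
  using kappa mu pw by (auto simp: \<rho>_def min_def)

lemma convex_X: "convex X"
  using polytope polytope_imp_convex by blast

lemma finite_V: "finite V"
  using polytope finite_polyhedron_extreme_points polytope_imp_polyhedron by blast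

lemma V_subset_X: "V \<subseteq> X"
  by (auto simp: extreme_point_of_def)

lemma X_eq_hull: "X = convex hull V"
  using Krein_Milman_Minkowski polytope polytope_imp_compact convex_X by blast

lemma comb_in_X:
  assumes "\<forall>u\<in>V. 0 \<le> l u" "sum l V = 1"
  shows "(\<Sum>u\<in>V. l u *\<^sub>R u) \<in> X"
  using assms by (subst X_eq_hull, subst convex_hull_finite[OF finite_V]) blast

lemma level_set:
  "convex (X \<inter> {z \<in> U. F z \<le> c0 + 1})" "X \<inter> {z \<in> U. F z \<le> c0 + 1} \<subseteq> U"
  using convex_Int[OF convex_X convex_sublevel] by auto

lemma level_upper:
  assumes "x \<in> X" "x \<in> U" "F x \<le> c0 + 1" "y \<in> X" "y \<in> U" "F y \<le> c0 + 1"
  shows "F y \<le> F x + grad f x \<bullet> (y - x) + L / 2 * (norm (y - x))\<^sup>2"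
  by (rule taylor_bounds(2)[OF level_set]) (use assms curvature in auto)

lemma level_lower:
  assumes "x \<in> X" "x \<in> U" "F x \<le> c0 + 1" "y \<in> X" "y \<in> U" "F y \<le> c0 + 1"
  shows "F x + grad f x \<bullet> (y - x) + \<mu> / 2 * (norm (y - x))\<^sup>2 \<le> F y"
  by (rule taylor_bounds(1)[OF level_set]) (use assms curvature in auto)

subsection \<open>Backtracking\<close>

text \<open>The set of \<open>s\<close> for which \<open>x + s d\<close> stays in the larger sublevel set is closed in \<open>[0, \<gamma>]\<close>;
  it is open as well, because short steps do not increase \<open>f\<close>.\<close>

lemma no_reject:
  assumes x: "x \<in> X" "x \<in> U" "F x \<le> c0"
    and y: "x + \<gamma> *\<^sub>R d \<in> X" and \<gamma>: "0 \<le> \<gamma>"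
    and short: "\<gamma> * (K * (norm d)\<^sup>2) \<le> - (grad f x \<bullet> d)" and K: "L \<le> K"
  shows "\<not> bt_reject f x d \<gamma> K"
proof -
  let ?p = "\<lambda>s. x + s *\<^sub>R d"
  define J where "J = {s \<in> {0..\<gamma>}. ?p s \<in> U \<and> F (?p s) \<le> c0 + 1}"
  have upper: "F (?p s) \<le> F x + s * (grad f x \<bullet> d) + L / 2 * (s\<^sup>2 * (norm d)\<^sup>2)" if "s \<in> J" for s
    using level_upper[of x "?p s"] that x convex_ray_segment[OF convex_X x(1) y, of s]
    by (simp add: J_def power_mult_distrib)
  have stay: "F (?p s) \<le> F x" if s: "s \<in> J" for s
  proof -
    have "s * (L * (norm d)\<^sup>2) \<le> \<gamma> * (K * (norm d)\<^sup>2)"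
      using s K L by (intro mult_mono) (auto simp: J_def)
    with short have "s * (L * (norm d)\<^sup>2) \<le> - (grad f x \<bullet> d)" by linarith
    then have "s * (s * (L * (norm d)\<^sup>2)) \<le> s * (- (grad f x \<bullet> d))"
      using s by (intro mult_left_mono) (auto simp: J_def)
    then have "s * (s * (L * (norm d)\<^sup>2)) \<le> - (s * (grad f x \<bullet> d))" by simp
    moreover have "0 \<le> s * (s * (L * (norm d)\<^sup>2))" using s L by (simp add: J_def)
    moreover have "L / 2 * (s\<^sup>2 * (norm d)\<^sup>2) = s * (s * (L * (norm d)\<^sup>2)) / 2"
      by (simp add: power2_eq_square)
    ultimately show ?thesis using upper[OF s] by linarith
  qed
  have "open {z \<in> U. F z < c0 + 1}"
    using continuous_open_preimage[OF continuous_on_F open_dom, of "{..<c0 + 1}"]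
    by (simp add: vimage_def Int_def)
  then have "open (?p -` {z \<in> U. F z < c0 + 1})"
    by (intro open_vimage) (auto intro!: continuous_intros)
  \<comment> \<open>By \<open>stay\<close>, points of \<open>J\<close> have level at most
    \<open>c0\<close>, so the bound \<open>c0 + 1\<close> holds strictly: this is what the slack 1
    is for.\<close>
  moreover have "J = {0..\<gamma>} \<inter> ?p -` {z \<in> U. F z < c0 + 1}"
    using stay x by (force simp: J_def)
  ultimately have op: "openin (top_of_set {0..\<gamma>}) J" by (auto simp: openin_open)
  have "closed (?p -` {z \<in> U. F z \<le> c0 + 1})"
    using closed_sublevel by (intro continuous_closed_vimage) (auto intro!: continuous_intros)
  moreover have "J = {0..\<gamma>} \<inter> ?p -` {z \<in> U. F z \<le> c0 + 1}" by (auto simp: J_def)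
  ultimately have cl: "closedin (top_of_set {0..\<gamma>}) J" by (auto simp: closedin_closed)
  have "0 \<in> J" using x \<gamma> by (simp add: J_def)
  with op cl have "J = {0..\<gamma>}" using connected_clopen[of "{0..\<gamma>}"] by fastforce
  then have J: "\<gamma> \<in> J" using \<gamma> by simp
  have "L / 2 * (\<gamma>\<^sup>2 * (norm d)\<^sup>2) \<le> K / 2 * (\<gamma>\<^sup>2 * (norm d)\<^sup>2)"
    using K by (intro mult_right_mono) auto
  then show ?thesis using upper[OF J] J by (simp add: bt_reject_def J_def mult.assoc)
qed

text \<open>The last bound is multiplied out so that it covers \<open>d = 0\<close> and passes on to
  shorter steps.\<close>

lemma bt_gamma_bounds:
  assumes "0 \<le> \<gamma>max" "0 < K" "0 \<le> - (grad f x \<bullet> d)"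
  shows "0 \<le> bt_gamma f x d \<gamma>max K" "bt_gamma f x d \<gamma>max K \<le> \<gamma>max"
    "bt_gamma f x d \<gamma>max K * (K * (norm d)\<^sup>2) \<le> - (grad f x \<bullet> d)"
proof -
  show "0 \<le> bt_gamma f x d \<gamma>max K" "bt_gamma f x d \<gamma>max K \<le> \<gamma>max"
    using assms by (auto simp: bt_gamma_def intro!: divide_nonpos_pos)
  show "bt_gamma f x d \<gamma>max K * (K * (norm d)\<^sup>2) \<le> - (grad f x \<bullet> d)"
  proof (cases "d = 0")
    case False
    then have "0 < K * (norm d)\<^sup>2" using assms by simp
    moreover have "bt_gamma f x d \<gamma>max K \<le> - (grad f x \<bullet> d) / (K * (norm d)\<^sup>2)"
      using False by (simp add: bt_gamma_def)
    ultimately show ?thesis by (simp only: pos_le_divide_eq)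
  qed simp
qed

text \<open>Acceptance gives a decrease of \<open>\<gamma> D - K \<gamma>^2 |d|^2 / 2\<close>, and
  \<open>\<gamma> K |d|^2 \<le> D\<close> makes this at least \<open>\<gamma> D / 2\<close>. The two
  alternatives are an uncapped and a capped step length.\<close>

lemma backtrack_progress:
  assumes x: "x \<in> X" "x \<in> U" "F x \<le> c0"
    and y: "x + \<gamma>max *\<^sub>R d \<in> X" and \<gamma>max: "0 \<le> \<gamma>max"
    and D: "0 \<le> D" "D = - (grad f x \<bullet> d)" and d: "norm d \<le> \<Delta>"
    and K0: "0 < K0" "K0 \<le> Kmax"
    and bt: "backtrack \<tau> \<eta> f x d K0 \<gamma>max (\<gamma>, K)"
  shows "0 < K" "K \<le> Kmax" "0 \<le> \<gamma>" "\<gamma> \<le> \<gamma>max" "x + \<gamma> *\<^sub>R d \<in> U" "F (x + \<gamma> *\<^sub>R d) \<le> F x"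
    "\<kappa> * D\<^sup>2 \<le> F x - F (x + \<gamma> *\<^sub>R d) \<or>
     \<gamma> = \<gamma>max \<and> \<gamma>max * D / 2 \<le> F x - F (x + \<gamma> *\<^sub>R d)"
proof -
  obtain K1 where K1: "K1 \<in> {\<eta> * K0..K0}"
    and wh: "while_option (\<lambda>(\<gamma>, K). bt_reject f x d \<gamma> K)
                     (\<lambda>(\<gamma>, K). (bt_gamma f x d \<gamma>max (\<tau> * K), \<tau> * K))
                     (bt_gamma f x d \<gamma>max K1, K1) = Some (\<gamma>, K)"
    using bt unfolding backtrack_def by blast
  have "0 < \<eta> * K0" using eta K0 by simp
  then have K1': "0 < K1" "K1 \<le> Kmax" using K1 K0 by auto
  \<comment> \<open>The invariant ties \<open>\<gamma>\<close> to \<open>K\<close>, because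
    \<open>no_reject\<close> applies only to steps that are short relative to
    \<open>K\<close>.\<close>
  define P where "P = (\<lambda>(\<gamma>, K). \<gamma> = bt_gamma f x d \<gamma>max K \<and> 0 < K \<and> K \<le> Kmax)"
  have "P (\<gamma>, K)"
  proof (rule while_option_rule[OF _ wh])
    show "P (bt_gamma f x d \<gamma>max K1, K1)" using K1' by (simp add: P_def)
    fix s assume s: "P s" and b: "case s of (\<gamma>, K) \<Rightarrow> bt_reject f x d \<gamma> K"
    obtain \<gamma>' K' where s': "s = (\<gamma>', K')" by (cases s)
    have P': "\<gamma>' = bt_gamma f x d \<gamma>max K'" "0 < K'" "K' \<le> Kmax"
      and rej: "bt_reject f x d \<gamma>' K'" using s b by (auto simp: P_def s')
    note g = bt_gamma_bounds[OF \<gamma>max P'(2), of x d, folded P'(1)]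
    have "\<not> L \<le> K'"
      using no_reject[OF x convex_ray_segment[OF convex_X x(1) y], of \<gamma>' K'] g D rej by auto
    then have "\<tau> * K' \<le> \<tau> * L" using tau by simp
    then have "\<tau> * K' \<le> Kmax" by (simp add: Kmax_def)
    then show "P (case s of (\<gamma>, K) \<Rightarrow> (bt_gamma f x d \<gamma>max (\<tau> * K), \<tau> * K))"
      using P' tau by (simp add: P_def s')
  qed
  then have g: "\<gamma> = bt_gamma f x d \<gamma>max K" and K: "0 < K" "K \<le> Kmax" by (auto simp: P_def)
  show "0 < K" "K \<le> Kmax" by fact+
  have acc: "x + \<gamma> *\<^sub>R d \<in> U" "F (x + \<gamma> *\<^sub>R d) - F x \<le> K * \<gamma>\<^sup>2 / 2 * (norm d)\<^sup>2 - \<gamma> * D"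
    using while_option_stop[OF wh] D by (auto simp: bt_reject_def)
  note gb = bt_gamma_bounds[OF \<gamma>max K(1), of x d, folded g D(2)]
  show \<gamma>: "0 \<le> \<gamma>" "\<gamma> \<le> \<gamma>max" "x + \<gamma> *\<^sub>R d \<in> U" using gb D acc by auto
  have "\<gamma> * (\<gamma> * (K * (norm d)\<^sup>2)) \<le> \<gamma> * D"
    using gb(3) D \<gamma> by (intro mult_left_mono) auto
  then have half: "\<gamma> * D / 2 \<le> F x - F (x + \<gamma> *\<^sub>R d)"
    using acc(2) by (simp add: power2_eq_square mult_ac)
  moreover have "0 \<le> \<gamma> * D" using \<gamma>(1) D(1) by (rule mult_nonneg_nonneg)
  ultimately show "F (x + \<gamma> *\<^sub>R d) \<le> F x" by linarith
  show "\<kappa> * D\<^sup>2 \<le> F x - F (x + \<gamma> *\<^sub>R d) \<or>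
     \<gamma> = \<gamma>max \<and> \<gamma>max * D / 2 \<le> F x - F (x + \<gamma> *\<^sub>R d)"
  proof (cases "\<gamma> = \<gamma>max")
    case True
    then show ?thesis using half by simp
  next
    case ne: False
    have "\<kappa> * D\<^sup>2 \<le> \<gamma> * D / 2"
    proof (cases "d = 0")
      case True
      then show ?thesis using D by (simp add: g bt_gamma_def)
    next
      case False
      then have nd: "0 < norm d" by simp
      have "\<gamma> = D / (K * (norm d)\<^sup>2)"
        using ne False D by (auto simp: g bt_gamma_def min_def split: if_splits)
      then have "\<gamma> * D / 2 = D\<^sup>2 / (2 * (K * (norm d)\<^sup>2))"
        by (simp add: power2_eq_square)
      moreover have "\<kappa> * D\<^sup>2 = D\<^sup>2 / (2 * (Kmax * \<Delta>\<^sup>2))" by (simp add: \<kappa>_def)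
      moreover have "K * (norm d)\<^sup>2 \<le> Kmax * \<Delta>\<^sup>2"
        using K d Kmax by (intro mult_mono power_mono) auto
      moreover have "0 < K * (norm d)\<^sup>2" using K nd by simp
      ultimately show ?thesis by (simp only:) (rule frac_le; (linarith | simp))
    qed
    with half show ?thesis by linarith
  qed
qed

subsection \<open>The invariant of the iterates\<close>

text \<open>Weights are summed over all vertices and \<open>S\<close> is recovered as their support,
  so index sets never change along a run.\<close>

definition inv :: "'n state \<Rightarrow> bool" where
  "inv = (\<lambda>(x, S, lam, K). (\<forall>u\<in>V. 0 \<le> lam u) \<and> sum lam V = 1 \<and> x = (\<Sum>u\<in>V. lam u *\<^sub>R u) \<and>
     S = active X lam \<and> x \<in> U \<and> F x \<le> c0 \<and> 0 < K \<and> K \<le> Kmax)"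

lemma inv_in_X: "inv (x, S, lam, K) \<Longrightarrow> x \<in> X"
  using comb_in_X by (auto simp: inv_def)

lemma inv_card:
  assumes "inv (x, S, lam, K)"
  shows "finite S" "1 \<le> card S" "card S \<le> card V"
proof -
  have S: "S = active X lam" "sum lam V = 1" "\<forall>u\<in>V. 0 \<le> lam u" using assms by (auto simp: inv_def)
  have sub: "S \<subseteq> V" by (auto simp: S active_def)
  then show fin: "finite S" using finite_V finite_subset by blast
  show "card S \<le> card V" using sub finite_V by (simp add: card_mono)
  have "S \<noteq> {}"
  proof
    assume "S = {}"
    then have "\<forall>u\<in>V. lam u = 0" using S by (force simp: active_def)
    then show False using S by simp
  qed
  then show "1 \<le> card S" using fin by (simp add: Suc_le_eq card_gt_0_iff)
qed

lemma inv_inner_x: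
  assumes "inv (x, S, lam, K)"
  shows "g \<bullet> x = (\<Sum>u\<in>V. lam u * (g \<bullet> u))"
  using assms by (simp add: inv_def inner_sum_right)

lemma inv_inner_ge:
  assumes inv: "inv (x, S, lam, K)" and s: "\<And>u. u \<in> S \<Longrightarrow> r \<le> g \<bullet> u"
  shows "r \<le> g \<bullet> x"
proof -
  have l: "\<forall>u\<in>V. 0 \<le> lam u" "sum lam V = 1" "S = active X lam" using inv by (auto simp: inv_def)
  have "lam u * r \<le> lam u * (g \<bullet> u)" if "u \<in> V" for u
    using l that s[of u] by (cases "lam u = 0") (auto simp: active_def less_le)
  then have "(\<Sum>u\<in>V. lam u * r) \<le> (\<Sum>u\<in>V. lam u * (g \<bullet> u))" by (intro sum_mono) blast
  then show ?thesis using l by (simp add: inv_inner_x[OF inv] sum_distrib_right[symmetric])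
qed

text \<open>All three kinds of steps move the weights along some direction \<open>e\<close> with total mass \<open>0\<close>.\<close>

lemma weight_step:
  assumes inv: "inv (x, S, lam, K0)"
    and e: "sum e V = 0" "d = (\<Sum>u\<in>V. e u *\<^sub>R u)"
    and \<gamma>max: "0 \<le> \<gamma>max" "\<And>u. u \<in> V \<Longrightarrow> 0 \<le> lam u + \<gamma>max * e u"
    and D: "0 \<le> D" "D = - (grad f x \<bullet> d)" and d: "norm d \<le> \<Delta>"
    and bt: "backtrack \<tau> \<eta> f x d K0 \<gamma>max (\<gamma>, K)"
    and lam': "\<And>u. u \<in> V \<Longrightarrow> lam' u = lam u + \<gamma> * e u"
  shows "inv (x + \<gamma> *\<^sub>R d, active X lam', lam', K)" "0 \<le> \<gamma>" "\<gamma> \<le> \<gamma>max"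
    "F (x + \<gamma> *\<^sub>R d) \<le> F x"
    "\<kappa> * D\<^sup>2 \<le> F x - F (x + \<gamma> *\<^sub>R d) \<or>
     \<gamma> = \<gamma>max \<and> \<gamma>max * D / 2 \<le> F x - F (x + \<gamma> *\<^sub>R d)"
proof -
  have i: "\<forall>u\<in>V. 0 \<le> lam u" "sum lam V = 1" "x = (\<Sum>u\<in>V. lam u *\<^sub>R u)" "x \<in> U" "F x \<le> c0"
    "0 < K0" "K0 \<le> Kmax" using inv by (auto simp: inv_def)
  have move: "x + s *\<^sub>R d = (\<Sum>u\<in>V. (lam u + s * e u) *\<^sub>R u)" for s
    by (simp add: i(3) e(2) scaleR_add_left sum.distrib scaleR_sum_right)
  have mass: "(\<Sum>u\<in>V. lam u + s * e u) = 1" for s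
    using i(2) e(1) by (simp add: sum.distrib sum_distrib_left[symmetric])
  have y: "x + \<gamma>max *\<^sub>R d \<in> X" unfolding move using \<gamma>max mass by (intro comb_in_X) auto
  note bp = backtrack_progress[OF inv_in_X[OF inv] i(4,5) y \<gamma>max(1) D d i(6,7) bt]
  show "0 \<le> \<gamma>" "\<gamma> \<le> \<gamma>max" "F (x + \<gamma> *\<^sub>R d) \<le> F x"
    "\<kappa> * D\<^sup>2 \<le> F x - F (x + \<gamma> *\<^sub>R d) \<or>
     \<gamma> = \<gamma>max \<and> \<gamma>max * D / 2 \<le> F x - F (x + \<gamma> *\<^sub>R d)" by fact+
  \<comment> \<open>The weight is affine in the step length and nonnegative at both ends of
    \<open>[0, \<gamma>max]\<close>.\<close>
  have "0 \<le> lam' u" if u: "u \<in> V" for u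
  proof (cases "0 \<le> e u")
    case True
    then show ?thesis using lam'[OF u] i(1) u bp(3) by simp
  next
    case False
    then have "\<gamma>max * e u \<le> \<gamma> * e u" using bp(4) by (intro mult_right_mono_neg) auto
    then show ?thesis using lam'[OF u] \<gamma>max(2)[OF u] by simp
  qed
  moreover have "sum lam' V = 1" "x + \<gamma> *\<^sub>R d = (\<Sum>u\<in>V. lam' u *\<^sub>R u)"
    unfolding mass[of \<gamma>, symmetric] move by (intro sum.cong refl; use lam' in simp)+
  ultimately show "inv (x + \<gamma> *\<^sub>R d, active X lam', lam', K)"
    using bp i(5) by (auto simp: inv_def)
qed

section \<open>Measures of progress and the two outcomes of a step\<close>

definition gap_of :: "'n state \<Rightarrow> real" where
  "gap_of st = fw_gap f X (fst st)"

definition primal_gap :: "'n state \<Rightarrow> real" where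
  "primal_gap st = F (fst st) - F xm"

definition active_card :: "'n state \<Rightarrow> nat" where
  "active_card st = card (fst (snd st))"

text \<open>Truncating the gap at 1 makes its square at most itself, which merges the decreases
  \<open>\<kappa> * D\<^sup>2\<close> and \<open>D / 2\<close> into one quadratic bound.\<close>

definition good_step :: "'n state \<Rightarrow> 'n state \<Rightarrow> bool" where
  "good_step st st' \<longleftrightarrow> primal_gap st' \<le> \<rho> * primal_gap st \<and>
     active_card st' \<le> Suc (active_card st) \<and>
     (0 < gap_of st \<longrightarrow> min \<kappa> (1 / 2) * (min 1 (gap_of st))\<^sup>2 \<le> primal_gap st)"

definition drop_step :: "'n state \<Rightarrow> 'n state \<Rightarrow> bool" where
  "drop_step st st' \<longleftrightarrow> primal_gap st' \<le> primal_gap st \<and> active_card st' < active_card st"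

text \<open>\<open>D\<close> stands for the decrease rate of the chosen step. Strong convexity and
  the width give \<open>pw * (h + \<mu> / 2 * r\<^sup>2) \<le> 2 * D * r\<close>, where
  \<open>r\<close> is the unknown distance to \<open>xm\<close>; eliminating \<open>r\<close> bounds
  \<open>h\<close> by a multiple of \<open>D\<^sup>2\<close>.\<close>

lemma good_stepI:
  assumes inv: "inv (x, S, lam, K)" and inv': "inv (x', S', lam', K')"
    and v: "fw_vertex f X x v"
    and a: "is_arg_max (\<lambda>v. grad f x \<bullet> v) (\<lambda>v. v \<in> S) a"
    and D: "grad f x \<bullet> (x - v) \<le> D" "grad f x \<bullet> (a - v) \<le> 2 * D"
    and decrease: "\<kappa> * D\<^sup>2 \<le> F x - F x' \<or> D / 2 \<le> F x - F x'"
    and card: "card S' \<le> Suc (card S)"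
  shows "good_step (x, S, lam, K) (x', S', lam', K')"
proof -
  let ?g = "grad f x"
  have vX: "\<And>u. u \<in> X \<Longrightarrow> ?g \<bullet> v \<le> ?g \<bullet> u" "v \<in> X"
    using v by (auto simp: fw_vertex_def is_arg_min_def not_less)
  have x: "x \<in> X" "x \<in> U" "F x \<le> c0" using inv inv_in_X by (auto simp: inv_def)
  have x': "x' \<in> X" "x' \<in> U" using inv' inv_in_X by (auto simp: inv_def)
  define h r where "h = F x - F xm" and "r = norm (x - xm)"
  have h: "0 \<le> h" "0 \<le> F x' - F xm" using xm x x' by (auto simp: h_def)
  have "F xm \<le> c0 + 1" using xm(3)[OF x(1,2)] x(3) by simp
  then have lower: "h + \<mu> / 2 * r\<^sup>2 \<le> ?g \<bullet> (x - xm)"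
    using level_lower[of x xm] x xm by (simp add: h_def r_def inner_diff_right norm_minus_commute)
  have "0 \<le> \<mu> / 2 * r\<^sup>2" using mu by simp
  moreover have "?g \<bullet> (x - xm) \<le> ?g \<bullet> (x - v)" using vX(1)[OF xm(1)] by (simp add: inner_diff_right)
  ultimately have hD: "h \<le> D" using lower D by linarith
  have D0: "0 \<le> D" using h hD by simp
  have "pw * (?g \<bullet> (x - xm)) \<le> (?g \<bullet> (a - v)) * r"
  proof -
    have lam: "\<forall>u\<in>V. 0 \<le> lam u" "sum lam V = 1" "x = (\<Sum>u\<in>V. lam u *\<^sub>R u)" "S = active X lam"
      using inv by (auto simp: inv_def)
    have "\<forall>u\<in>V. 0 < lam u \<longrightarrow> ?g \<bullet> u \<le> ?g \<bullet> a"
      using a lam(4) by (auto simp: is_arg_max_def active_def not_less)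
    moreover have "\<forall>u\<in>V. ?g \<bullet> v \<le> ?g \<bullet> u" using vX V_subset_X by blast
    moreover have "xm \<in> convex hull V" using xm(1) X_eq_hull by simp
    ultimately show ?thesis using width lam by (simp add: r_def)
  qed
  also have "\<dots> \<le> 2 * D * r" using D by (intro mult_right_mono) (auto simp: r_def)
  finally have "pw * (?g \<bullet> (x - xm)) \<le> 2 * D * r" .
  moreover have "pw * (h + \<mu> / 2 * r\<^sup>2) \<le> pw * (?g \<bullet> (x - xm))"
    using lower pw by (intro mult_left_mono) auto
  ultimately have key: "pw * (h + \<mu> / 2 * r\<^sup>2) \<le> 2 * D * r" by linarith
  have quadratic: "\<mu> * pw\<^sup>2 / 2 * h \<le> D\<^sup>2"
  proof (cases "r = 0")
    case True
    then have "h = 0" by (simp add: r_def h_def)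
    then show ?thesis by simp
  next
    case False
    then have r: "0 < r" by (simp add: r_def)
    \<comment> \<open>The inequality \<open>4ab \<le> (a + b)^2\<close> produces a factor
      \<open>r\<^sup>2\<close> on the left that cancels against the right-hand side of
      \<open>key\<close>.\<close>
    have "4 * h * (\<mu> / 2 * r\<^sup>2) \<le> (h + \<mu> / 2 * r\<^sup>2)\<^sup>2"
      using zero_le_power2[of "h - \<mu> / 2 * r\<^sup>2"] by (simp add: power2_eq_square algebra_simps)
    then have "pw\<^sup>2 * (4 * h * (\<mu> / 2 * r\<^sup>2)) \<le> pw\<^sup>2 * (h + \<mu> / 2 * r\<^sup>2)\<^sup>2"
      by (intro mult_left_mono) auto
    also have "\<dots> = (pw * (h + \<mu> / 2 * r\<^sup>2))\<^sup>2" by (simp add: power_mult_distrib)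
    also have "\<dots> \<le> (2 * D * r)\<^sup>2"
      using key pw h mu by (intro power_mono) auto
    finally have "(\<mu> * pw\<^sup>2 / 2 * h) * (4 * r\<^sup>2) \<le> D\<^sup>2 * (4 * r\<^sup>2)"
      by (simp add: power_mult_distrib mult_ac)
    then show ?thesis using r by (simp only: mult_le_cancel_right) auto
  qed
  have dec: "min (\<kappa> * D\<^sup>2) (D / 2) \<le> F x - F x'" using decrease by linarith
  have "(1 - \<rho>) * h \<le> \<kappa> * D\<^sup>2"
  proof -
    have "(1 - \<rho>) * h \<le> (\<kappa> * \<mu> * pw\<^sup>2 / 2) * h"
      using h(1) by (intro mult_right_mono) (auto simp: \<rho>_def)
    also have "\<dots> = \<kappa> * (\<mu> * pw\<^sup>2 / 2 * h)" by simp
    also have "\<dots> \<le> \<kappa> * D\<^sup>2" using quadratic kappa by (intro mult_left_mono) auto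
    finally show ?thesis .
  qed
  moreover have "(1 - \<rho>) * h \<le> D / 2"
  proof -
    have "(1 - \<rho>) * h \<le> 1 / 2 * h" using h(1) by (intro mult_right_mono) (auto simp: \<rho>_def)
    then show ?thesis using hD by linarith
  qed
  ultimately have "(1 - \<rho>) * h \<le> F x - F x'" using dec by linarith
  then have contraction: "F x' - F xm \<le> \<rho> * (F x - F xm)" by (simp add: h_def algebra_simps)
  have gap: "fw_gap f X x \<le> D"
  proof -
    have "fw_gap f X x \<le> ?g \<bullet> (x - v)"
      unfolding fw_gap_def using vX by (intro cSUP_least) (auto simp: inner_diff_right)
    then show ?thesis using D by simp
  qed
  have "min \<kappa> (1 / 2) * (min 1 (fw_gap f X x))\<^sup>2 \<le> h" if "0 < fw_gap f X x"
  proof -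
    define m where "m = min 1 (fw_gap f X x)"
    have m: "0 < m" "m \<le> 1" "m \<le> D" using that gap by (auto simp: m_def)
    have "m\<^sup>2 \<le> D\<^sup>2" using m by (intro power_mono) auto
    then have "min \<kappa> (1 / 2) * m\<^sup>2 \<le> \<kappa> * D\<^sup>2" using kappa by (intro mult_mono) auto
    moreover have "m * m \<le> m * 1" using m by (intro mult_left_mono) auto
    then have "m\<^sup>2 \<le> D" using m unfolding power2_eq_square by linarith
    then have "min \<kappa> (1 / 2) * m\<^sup>2 \<le> 1 / 2 * D" using kappa by (intro mult_mono) auto
    \<comment> \<open>No step can decrease \<open>F\<close> by more than \<open>h\<close>, as
      \<open>xm\<close> is a minimiser; so the guaranteed decrease is a lower bound for
      \<open>h\<close>.\<close>
    ultimately show ?thesis using dec h by (simp add: m_def h_def)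
  qed
  then show ?thesis
    using contraction card
    by (simp add: good_step_def primal_gap_def active_card_def gap_of_def h_def)
qed

subsection \<open>Frank-Wolfe, away and pairwise steps\<close>

lemma fw_vertex_facts:
  assumes "fw_vertex f X x v" "x \<in> X"
  shows "v \<in> V" "v \<in> X" "0 \<le> grad f x \<bullet> (x - v)"
  using assms by (auto simp: fw_vertex_def is_arg_min_def not_less inner_diff_right)

text \<open>Never a drop step in this accounting: even at the cap \<open>\<gamma> = 1\<close> the
  decrease \<open>D / 2\<close> suffices, and \<open>v\<close> is the only vertex that can be
  added.\<close>

lemma fw_update_good:
  assumes inv: "inv (x, S, lam, K)" and v: "fw_vertex f X x v"
    and a: "is_arg_max (\<lambda>v. grad f x \<bullet> v) (\<lambda>v. v \<in> S) a"
    and cmp: "grad f x \<bullet> (a - v) \<le> 2 * (grad f x \<bullet> (x - v))"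
    and up: "fw_update \<tau> \<eta> f X v (x, S, lam, K) st'"
  shows "inv st' \<and> good_step (x, S, lam, K) st'"
proof -
  obtain x' S' lam' K' \<gamma> where st': "st' = (x', S', lam', K')"
    and bt: "backtrack \<tau> \<eta> f x (v - x) K 1 (\<gamma>, K')"
    and x': "x' = x + \<gamma> *\<^sub>R (v - x)"
    and lam': "lam' = (\<lambda>u. (1 - \<gamma>) * lam u + (if u = v then \<gamma> else 0))"
    and S': "S' = active X lam'"
    using up by (cases st') (auto simp: fw_update_def)
  have i: "\<forall>u\<in>V. 0 \<le> lam u" "sum lam V = 1" "x = (\<Sum>u\<in>V. lam u *\<^sub>R u)" "S = active X lam"
    using inv by (auto simp: inv_def)
  have xX: "x \<in> X" using inv_in_X[OF inv] .
  note vf = fw_vertex_facts[OF v xX]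
  define e where "e u = (if u = v then 1 else 0) - lam u" for u
  have e: "sum e V = 0" "v - x = (\<Sum>u\<in>V. e u *\<^sub>R u)"
    using vf(1) finite_V i
    by (simp_all add: e_def sum_subtractf scaleR_diff_left if_distrib[of "\<lambda>c. c *\<^sub>R _"] cong: if_cong)
  have nn: "0 \<le> lam u + 1 * e u" for u by (simp add: e_def)
  have D: "grad f x \<bullet> (x - v) = - (grad f x \<bullet> (v - x))" by (simp add: inner_diff_right)
  have l: "lam' u = lam u + \<gamma> * e u" for u by (simp add: lam' e_def algebra_simps)
  note ws = weight_step[OF inv e zero_le_one nn vf(3) D diameter[OF vf(2) xX] bt l]
  have inv': "inv (x', S', lam', K')" using ws(1) by (simp add: x' S')
  have "S' \<subseteq> insert v S"
    using ws(2,3) by (auto simp: S' i(4) active_def lam' zero_less_mult_iff split: if_splits)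
  then have "card S' \<le> Suc (card S)"
    using card_mono[of "insert v S" S'] inv_card(1)[OF inv]
    by (simp add: card_insert_if split: if_splits)
  moreover have "\<kappa> * (grad f x \<bullet> (x - v))\<^sup>2 \<le> F x - F x' \<or> (grad f x \<bullet> (x - v)) / 2 \<le> F x - F x'"
    using ws(5) by (auto simp: x')
  ultimately show ?thesis using good_stepI[OF inv inv' v a order_refl cmp] inv' st' by blast
qed

text \<open>The cap solves \<open>(1 + \<gamma>) * lam a = \<gamma>\<close>, so a capped step
  removes \<open>a\<close> and needs no quantitative decrease; otherwise the quadratic decrease is
  available.\<close>

lemma away_update_progress:
  assumes inv: "inv (x, S, lam, K)" and v: "fw_vertex f X x v"
    and a: "is_arg_max (\<lambda>v. grad f x \<bullet> v) (\<lambda>v. v \<in> S) a"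
    and cmp: "grad f x \<bullet> (x - v) < grad f x \<bullet> (a - x)"
    and up: "away_update \<tau> \<eta> f X a (x, S, lam, K) st'"
  shows "inv st' \<and> (good_step (x, S, lam, K) st' \<or> drop_step (x, S, lam, K) st')"
proof -
  let ?\<gamma>m = "lam a / (1 - lam a)"
  obtain x' S' lam' K' \<gamma> where st': "st' = (x', S', lam', K')"
    and bt: "backtrack \<tau> \<eta> f x (x - a) K ?\<gamma>m (\<gamma>, K')"
    and x': "x' = x + \<gamma> *\<^sub>R (x - a)"
    and lam': "lam' = (\<lambda>u. (1 + \<gamma>) * lam u - (if u = a then \<gamma> else 0))"
    and S': "S' = active X lam'"
    using up by (cases st') (auto simp: away_update_def)
  have i: "\<forall>u\<in>V. 0 \<le> lam u" "sum lam V = 1" "x = (\<Sum>u\<in>V. lam u *\<^sub>R u)" "S = active X lam"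
    using inv by (auto simp: inv_def)
  have xX: "x \<in> X" using inv_in_X[OF inv] .
  note vf = fw_vertex_facts[OF v xX]
  have aS: "a \<in> S" "a \<in> V" "0 < lam a" using a i(4) by (auto simp: is_arg_max_def active_def)
  have split: "sum lam V = lam a + sum lam (V - {a})"
    using finite_V aS(2) by (simp add: sum.remove)
  have rest: "0 \<le> sum lam (V - {a})" using i(1) by (intro sum_nonneg) auto
  \<comment> \<open>Makes the cap meaningful: for \<open>lam a = 1\<close> the iterate would be
    \<open>a\<close> itself, and the away side of the comparison would be 0.\<close>
  have la: "lam a < 1"
  proof (rule ccontr)
    assume "\<not> lam a < 1"
    then have "sum lam (V - {a}) = 0" using split rest i(2) by linarith
    then have "\<forall>u\<in>V - {a}. lam u = 0"
      using i(1) finite_V by (subst (asm) sum_nonneg_eq_0_iff) auto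
    moreover have "lam a = 1" using split i(2) \<open>sum lam (V - {a}) = 0\<close> by simp
    moreover have "x = lam a *\<^sub>R a + (\<Sum>u\<in>V - {a}. lam u *\<^sub>R u)"
      unfolding i(3) using finite_V aS(2) by (subst sum.remove[of _ a]) auto
    ultimately have "x = a" by simp
    then show False using cmp vf(3) by simp
  qed
  define e where "e u = lam u - (if u = a then 1 else 0)" for u
  have e: "sum e V = 0" "x - a = (\<Sum>u\<in>V. e u *\<^sub>R u)"
    using aS(2) finite_V i
    by (simp_all add: e_def sum_subtractf scaleR_diff_left if_distrib[of "\<lambda>c. c *\<^sub>R _"] cong: if_cong)
  have \<gamma>m: "0 \<le> ?\<gamma>m" using la aS by simp
  have zero: "lam a + ?\<gamma>m * e a = 0" using la by (simp add: e_def field_simps)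
  have nn: "0 \<le> lam u + ?\<gamma>m * e u" if "u \<in> V" for u
  proof (cases "u = a")
    case True
    then show ?thesis using zero by simp
  next
    case False
    then have "e u = lam u" by (simp add: e_def)
    then show ?thesis using \<gamma>m i(1) that by (simp del: times_divide_eq_left)
  qed
  have D: "grad f x \<bullet> (a - x) = - (grad f x \<bullet> (x - a))" by (simp add: inner_diff_right)
  have D0: "0 \<le> grad f x \<bullet> (a - x)" using cmp vf(3) by simp
  have l: "lam' u = lam u + \<gamma> * e u" for u by (simp add: lam' e_def algebra_simps)
  have "a \<in> X" using aS V_subset_X by blast
  note ws = weight_step[OF inv e \<gamma>m nn D0 D diameter[OF xX this] bt l]
  have inv': "inv (x', S', lam', K')" using ws(1) by (simp add: x' S')
  have sub: "S' \<subseteq> S"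
    using ws(2) aS by (auto simp: S' i(4) active_def lam' zero_less_mult_iff split: if_splits)
  from ws(5) show ?thesis
  proof
    assume "\<kappa> * (grad f x \<bullet> (a - x))\<^sup>2 \<le> F x - F (x + \<gamma> *\<^sub>R (x - a))"
    moreover have "card S' \<le> Suc (card S)" using card_mono[OF inv_card(1)[OF inv] sub] by simp
    moreover have "grad f x \<bullet> (a - v) \<le> 2 * (grad f x \<bullet> (a - x))"
      using cmp by (simp add: inner_diff_right)
    ultimately have "good_step (x, S, lam, K) st'"
      using good_stepI[OF inv inv' v a less_imp_le[OF cmp]] st' x' by blast
    then show ?thesis using inv' st' by blast
  next
    assume "\<gamma> = ?\<gamma>m \<and> ?\<gamma>m * (grad f x \<bullet> (a - x)) / 2 \<le> F x - F (x + \<gamma> *\<^sub>R (x - a))"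
    then have "lam' a = 0" using l zero by simp
    then have "a \<notin> S'" by (simp add: S' active_def)
    then have "S' \<subset> S" using sub aS by blast
    then have "card S' < card S" using inv_card(1)[OF inv] by (rule psubset_card_mono[rotated])
    then show ?thesis
      using inv' ws(4) by (simp add: st' x' drop_step_def primal_gap_def active_card_def)
  qed
qed

text \<open>Mass moves to \<open>s\<close>, which is already active, so the active set cannot grow
  and a capped step strictly shrinks it. This rules out swaps of one vertex for a new one, which
  neither shrink the set nor guarantee enough decrease.\<close>

lemma pairwise_update_progress:
  assumes inv: "inv (x, S, lam, K)" and v: "fw_vertex f X x v"
    and a: "is_arg_max (\<lambda>v. grad f x \<bullet> v) (\<lambda>v. v \<in> S) a"
    and s: "is_arg_min (\<lambda>v. grad f x \<bullet> v) (\<lambda>v. v \<in> S) s"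
    and cmp: "grad f x \<bullet> (x - v) < grad f x \<bullet> (a - s)"
    and up: "pairwise_update \<tau> \<eta> f X a s (x, S, lam, K) st'"
  shows "inv st' \<and> (good_step (x, S, lam, K) st' \<or> drop_step (x, S, lam, K) st')"
proof -
  obtain x' S' lam' K' \<gamma> where st': "st' = (x', S', lam', K')"
    and bt: "backtrack \<tau> \<eta> f x (s - a) K (lam a) (\<gamma>, K')"
    and x': "x' = x + \<gamma> *\<^sub>R (s - a)"
    and lam': "lam' = (\<lambda>u. lam u + (if u = s then \<gamma> else 0) - (if u = a then \<gamma> else 0))"
    and S': "S' = active X lam'"
    using up by (cases st') (auto simp: pairwise_update_def)
  have i: "\<forall>u\<in>V. 0 \<le> lam u" "sum lam V = 1" "x = (\<Sum>u\<in>V. lam u *\<^sub>R u)" "S = active X lam"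
    using inv by (auto simp: inv_def)
  have xX: "x \<in> X" using inv_in_X[OF inv] .
  note vf = fw_vertex_facts[OF v xX]
  have aS: "a \<in> S" "a \<in> V" "0 < lam a" using a i(4) by (auto simp: is_arg_max_def active_def)
  have sS: "s \<in> S" "s \<in> V" "0 < lam s" using s i(4) by (auto simp: is_arg_min_def active_def)
  have "s \<noteq> a" using cmp vf(3) by auto
  define e :: "real ^ 'n \<Rightarrow> real" where "e u = (if u = s then 1 else 0) - (if u = a then 1 else 0)" for u
  have e: "sum e V = 0" "s - a = (\<Sum>u\<in>V. e u *\<^sub>R u)"
    using aS(2) sS(2) finite_V
    by (simp_all add: e_def sum_subtractf scaleR_diff_left if_distrib[of "\<lambda>c. c *\<^sub>R _"] cong: if_cong)
  have nn: "0 \<le> lam u + lam a * e u" if "u \<in> V" for u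
    using i(1) that aS by (auto simp: e_def)
  have D: "grad f x \<bullet> (a - s) = - (grad f x \<bullet> (s - a))" by (simp add: inner_diff_right)
  have D0: "0 \<le> grad f x \<bullet> (a - s)" using cmp vf(3) by simp
  have l: "lam' u = lam u + \<gamma> * e u" for u by (simp add: lam' e_def)
  have "s \<in> X" "a \<in> X" using aS sS V_subset_X by blast+
  note ws = weight_step[OF inv e less_imp_le[OF aS(3)] nn D0 D diameter[OF this] bt l]
  have inv': "inv (x', S', lam', K')" using ws(1) by (simp add: x' S')
  have sub: "S' \<subseteq> S"
    using ws(2) aS sS by (auto simp: S' i(4) active_def lam' split: if_splits)
  from ws(5) show ?thesis
  proof
    assume "\<kappa> * (grad f x \<bullet> (a - s))\<^sup>2 \<le> F x - F (x + \<gamma> *\<^sub>R (s - a))"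
    moreover have "card S' \<le> Suc (card S)" using card_mono[OF inv_card(1)[OF inv] sub] by simp
    \<comment> \<open>Gives \<open>g \<bullet> (a - x) \<le> g \<bullet> (a - s)\<close> for the
      gradient \<open>g\<close>, so that both halves of \<open>a - v\<close> are bounded by the
      pairwise rate.\<close>
    moreover have "grad f x \<bullet> s \<le> grad f x \<bullet> x"
      using s by (intro inv_inner_ge[OF inv]) (auto simp: is_arg_min_def not_less)
    then have "grad f x \<bullet> (a - v) \<le> 2 * (grad f x \<bullet> (a - s))"
      using cmp by (simp add: inner_diff_right)
    ultimately have "good_step (x, S, lam, K) st'"
      using good_stepI[OF inv inv' v a less_imp_le[OF cmp]] st' x' by blast
    then show ?thesis using inv' st' by blast
  next
    assume "\<gamma> = lam a \<and> lam a * (grad f x \<bullet> (a - s)) / 2 \<le> F x - F (x + \<gamma> *\<^sub>R (s - a))"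
    then have "lam' a = 0" using l \<open>s \<noteq> a\<close> by (simp add: e_def)
    then have "a \<notin> S'" by (simp add: S' active_def)
    then have "S' \<subset> S" using sub aS by blast
    then have "card S' < card S" using inv_card(1)[OF inv] by (rule psubset_card_mono[rotated])
    then show ?thesis
      using inv' ws(4) by (simp add: st' x' drop_step_def primal_gap_def active_card_def)
  qed
qed

section \<open>From single steps to the rate of both algorithms\<close>

lemma bafw_progress:
  assumes "inv st" "bafw_step \<tau> \<eta> f X st st'"
  shows "inv st' \<and> (good_step st st' \<or> drop_step st st')"
proof -
  obtain x S lam K where st: "st = (x, S, lam, K)" by (cases st)
  obtain v a where *: "fw_vertex f X x v" "is_arg_max (\<lambda>v. grad f x \<bullet> v) (\<lambda>v. v \<in> S) a"
    "if grad f x \<bullet> (x - v) \<ge> grad f x \<bullet> (a - x)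
        then fw_update \<tau> \<eta> f X v (x, S, lam, K) st'
        else away_update \<tau> \<eta> f X a (x, S, lam, K) st'"
    using assms(2) unfolding st bafw_step_def by auto
  show ?thesis
  proof (cases "grad f x \<bullet> (x - v) \<ge> grad f x \<bullet> (a - x)")
    case True
    then have "grad f x \<bullet> (a - v) \<le> 2 * (grad f x \<bullet> (x - v))" by (simp add: inner_diff_right)
    then show ?thesis using fw_update_good * True assms(1) unfolding st by auto
  next
    case False
    then show ?thesis using away_update_progress * assms(1) unfolding st by auto
  qed
qed

lemma bbpcg_progress:
  assumes "inv st" "bbpcg_step \<tau> \<eta> f X st st'"
  shows "inv st' \<and> (good_step st st' \<or> drop_step st st')"
proof -
  obtain x S lam K where st: "st = (x, S, lam, K)" by (cases st)
  obtain v a s where *: "fw_vertex f X x v" "is_arg_max (\<lambda>v. grad f x \<bullet> v) (\<lambda>v. v \<in> S) a"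
    "is_arg_min (\<lambda>v. grad f x \<bullet> v) (\<lambda>v. v \<in> S) s"
    "if grad f x \<bullet> (x - v) \<ge> grad f x \<bullet> (a - s)
        then fw_update \<tau> \<eta> f X v (x, S, lam, K) st'
        else pairwise_update \<tau> \<eta> f X a s (x, S, lam, K) st'"
    using assms(2) unfolding st bbpcg_step_def by auto
  have "grad f x \<bullet> s \<le> grad f x \<bullet> x"
    using *(3) assms(1) unfolding st
    by (intro inv_inner_ge[of x S lam K]) (auto simp: is_arg_min_def not_less)
  show ?thesis
  proof (cases "grad f x \<bullet> (x - v) \<ge> grad f x \<bullet> (a - s)")
    case True
    then have "grad f x \<bullet> (a - v) \<le> 2 * (grad f x \<bullet> (x - v))"
      using \<open>grad f x \<bullet> s \<le> grad f x \<bullet> x\<close> by (simp add: inner_diff_right)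
    then show ?thesis using fw_update_good * True assms(1) unfolding st by auto
  next
    case False
    then show ?thesis using pairwise_update_progress * assms(1) unfolding st by auto
  qed
qed

text \<open>Stated for any step relation with these two outcomes, so both algorithms share it; the
  constants are fixed before \<open>\<epsilon>\<close> and the run.\<close>

lemma gap_rate:
  assumes x0: "x0 extreme_point_of X" "x0 \<in> U" "F x0 \<le> c0"
    and step: "\<And>st st'. inv st \<Longrightarrow> step st st' \<Longrightarrow> inv st' \<and> (good_step st st' \<or> drop_step st st')"
  shows "\<exists>C>0. \<exists>\<epsilon>0. 0 < \<epsilon>0 \<and> \<epsilon>0 < 1 \<and>
           (\<forall>\<epsilon> xs. 0 < \<epsilon> \<and> \<epsilon> \<le> \<epsilon>0 \<and> generated step x0 Linit xs \<longrightarrow>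
              (\<exists>T::nat. 1 \<le> T \<and> real T \<le> C * ln (1 / \<epsilon>) \<and>
                 (MIN t\<in>{1..T}. fw_gap f X (xs t)) \<le> \<epsilon>))"
proof -
  \<comment> \<open>The summand 1 keeps \<open>H\<close> positive when \<open>x0\<close> is already
    a minimiser.\<close>
  define H where "H = F x0 - F xm + 1"
  have H: "0 < H" using xm(3)[of x0] x0 V_subset_X by (auto simp: H_def)
  have "0 < min \<kappa> (1 / 2)" using kappa by simp
  from linear_rate_with_drops[OF this rho H, of "card V"]
  obtain C \<epsilon>0 :: real where C: "0 < C" "0 < \<epsilon>0" "\<epsilon>0 < 1"
    and rate: "\<forall>\<epsilon> h g n. 0 < \<epsilon> \<and> \<epsilon> \<le> \<epsilon>0 \<and> h 0 \<le> H \<and> (\<forall>t. 1 \<le> n t) \<and> (\<forall>t. n t \<le> card V) \<and>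
      (\<forall>t. h (Suc t) \<le> \<rho> * h t \<and> n (Suc t) \<le> Suc (n t) \<and>
             (0 < g t \<longrightarrow> min \<kappa> (1 / 2) * (min 1 (g t))\<^sup>2 \<le> h t) \<or>
           h (Suc t) \<le> h t \<and> n (Suc t) < n t) \<longrightarrow>
      (\<exists>T. 1 \<le> T \<and> real T \<le> C * ln (1 / \<epsilon>) \<and> (\<exists>t\<in>{1..T}. g t \<le> \<epsilon>))" by blast
  have "\<exists>T::nat. 1 \<le> T \<and> real T \<le> C * ln (1 / \<epsilon>) \<and> (MIN t\<in>{1..T}. fw_gap f X (xs t)) \<le> \<epsilon>"
    if \<epsilon>: "0 < \<epsilon>" "\<epsilon> \<le> \<epsilon>0" and gen: "generated step x0 Linit xs" for \<epsilon> xs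
  proof -
    obtain st where st0: "st 0 = init_state x0 Linit" and st: "\<And>t. step (st t) (st (Suc t))"
      and xs: "\<And>t. xs t = fst (st t)" using gen unfolding generated_def by blast
    have "inv (init_state x0 Linit)"
      using x0 finite_V Linit
      by (auto simp: inv_def init_state_def active_def Kmax_def if_distrib[of "\<lambda>c. c *\<^sub>R _"] cong: if_cong)
    then have inv: "inv (st t)" for t
      by (induction t) (use st0 st step in auto)
    have n: "1 \<le> active_card (st t)" "active_card (st t) \<le> card V" for t
      using inv_card inv[of t] by (cases "st t"; auto simp: active_card_def)+
    have "primal_gap (st 0) \<le> H" by (simp add: st0 init_state_def primal_gap_def H_def)
    moreover have "primal_gap (st (Suc t)) \<le> \<rho> * primal_gap (st t) \<and>
        active_card (st (Suc t)) \<le> Suc (active_card (st t)) \<and>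
        (0 < gap_of (st t) \<longrightarrow> min \<kappa> (1 / 2) * (min 1 (gap_of (st t)))\<^sup>2 \<le> primal_gap (st t)) \<or>
      primal_gap (st (Suc t)) \<le> primal_gap (st t) \<and> active_card (st (Suc t)) < active_card (st t)"
      for t
      using step[OF inv st, of t] unfolding good_step_def drop_step_def by blast
    ultimately obtain T t where T: "1 \<le> T" "real T \<le> C * ln (1 / \<epsilon>)" "t \<in> {1..T}" "gap_of (st t) \<le> \<epsilon>"
      using rate[rule_format, of \<epsilon> "\<lambda>t. primal_gap (st t)" "\<lambda>t. active_card (st t)" "\<lambda>t. gap_of (st t)"] n \<epsilon>
      by blast
    have "(MIN t\<in>{1..T}. fw_gap f X (xs t)) \<le> fw_gap f X (xs t)"
      using T(3) by (intro Min_le) auto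
    also have "\<dots> \<le> \<epsilon>" using T(4) by (simp add: gap_of_def xs)
    finally show ?thesis using T by blast
  qed
  then show ?thesis using C by blast
qed

end

theorem theorem3p3:
  fixes f :: "real ^ 'n \<Rightarrow> ereal"
    and X :: "(real ^ 'n) set"
    and x0 :: "real ^ 'n"
    and M \<nu> Linit \<tau> \<eta> :: real
  assumes "polytope X"
    and "gen_self_concordant M \<nu> f"
    and "\<nu> \<ge> 2"
    and "\<not> contains_line (effdom f)"
    and "x0 extreme_point_of X"
    and "x0 \<in> effdom f"
    and "Linit > 0"
    and "\<tau> > 1"
    and "0 < \<eta>" "\<eta> \<le> 1"
  shows "(\<exists>C>0. \<exists>\<epsilon>0. 0 < \<epsilon>0 \<and> \<epsilon>0 < 1 \<and>
           (\<forall>\<epsilon> xs. 0 < \<epsilon> \<and> \<epsilon> \<le> \<epsilon>0 \<and> generated (bafw_step \<tau> \<eta> f X) x0 Linit xs \<longrightarrow>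
              (\<exists>T::nat. 1 \<le> T \<and> real T \<le> C * ln (1 / \<epsilon>) \<and>
                 (MIN t\<in>{1..T}. fw_gap f X (xs t)) \<le> \<epsilon>))) \<and>
         (\<exists>C>0. \<exists>\<epsilon>0. 0 < \<epsilon>0 \<and> \<epsilon>0 < 1 \<and>
           (\<forall>\<epsilon> xs. 0 < \<epsilon> \<and> \<epsilon> \<le> \<epsilon>0 \<and> generated (bbpcg_step \<tau> \<eta> f X) x0 Linit xs \<longrightarrow>
              (\<exists>T::nat. 1 \<le> T \<and> real T \<le> C * ln (1 / \<epsilon>) \<and>
                 (MIN t\<in>{1..T}. fw_gap f X (xs t)) \<le> \<epsilon>)))"
proof -
  interpret gsc_no_line f M \<nu>
    using assms by unfold_locales
  define K where "K = X \<inter> {z \<in> U. F z \<le> F x0 + 1}"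
  have compact_X: "compact X" using assms(1) by (rule polytope_imp_compact)
  have K: "compact K" "K \<subseteq> U"
    unfolding K_def using compact_X closed_sublevel by (auto intro: compact_Int_closed)
  have x0: "x0 \<in> K" using assms by (auto simp: K_def extreme_point_of_def)
  then obtain \<mu> L where \<mu>L: "0 < \<mu>" "0 < L"
    and curv: "\<And>x u. x \<in> K \<Longrightarrow> \<mu> * (norm u)\<^sup>2 \<le> quad x u \<and> quad x u \<le> L * (norm u)\<^sup>2"
    using quad_bounds[OF K] by blast
  have "continuous_on K F" using continuous_on_F K(2) by (rule continuous_on_subset)
  then obtain xm where xm: "xm \<in> K" "\<And>x. x \<in> K \<Longrightarrow> F xm \<le> F x"
    using continuous_attains_inf[OF K(1)] x0 by blast
  \<comment> \<open>Points of \<open>X \<inter> U\<close> outside \<open>K\<close> have values above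
    \<open>F x0 + 1\<close>, so the minimiser over \<open>K\<close> is global on
    \<open>X \<inter> U\<close>.\<close>
  have min: "F xm \<le> F x" if "x \<in> X" "x \<in> U" for x
  proof (cases "F x \<le> F x0 + 1")
    case True
    then show ?thesis using xm that by (simp add: K_def)
  next
    case False
    then show ?thesis using xm(2)[OF x0] by simp
  qed
  have "finite {u. u extreme_point_of X}"
    using assms(1) finite_polyhedron_extreme_points polytope_imp_polyhedron by blast
  from pyramidal_width[OF this] obtain pw where pw: "0 < pw" and
    width: "\<forall>l y g a v.
      (\<forall>u\<in>{u. u extreme_point_of X}. 0 \<le> l u) \<and> sum l {u. u extreme_point_of X} = 1 \<and>
      y \<in> convex hull {u. u extreme_point_of X} \<and>
      (\<forall>u\<in>{u. u extreme_point_of X}. 0 < l u \<longrightarrow> g \<bullet> u \<le> g \<bullet> a) \<and>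
      (\<forall>u\<in>{u. u extreme_point_of X}. g \<bullet> v \<le> g \<bullet> u) \<longrightarrow>
      pw * (g \<bullet> ((\<Sum>u\<in>{u. u extreme_point_of X}. l u *\<^sub>R u) - y))
        \<le> (g \<bullet> (a - v)) * norm ((\<Sum>u\<in>{u. u extreme_point_of X}. l u *\<^sub>R u) - y)"
    by blast
  \<comment> \<open>Adding 1 keeps the bound positive when \<open>X\<close> is a single
    point.\<close>
  have diam: "norm (x - y) \<le> diameter X + 1" if "x \<in> X" "y \<in> X" for x y
    using diameter_bounded_bound[OF compact_imp_bounded[OF compact_X] that] by (simp add: dist_norm)
  have "0 < diameter X + 1"
    using diameter_ge_0[OF compact_imp_bounded[OF compact_X]] by linarith
  then interpret fw_constants f X xm "F x0" \<mu> L "diameter X + 1" \<tau> \<eta> Linit pw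
    using assms \<mu>L pw width curv diam xm(1) min by unfold_locales (auto simp: K_def)
  show ?thesis
    using gap_rate[OF assms(5,6) order_refl bafw_progress]
      gap_rate[OF assms(5,6) order_refl bbpcg_progress] by blast
qed

end
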